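(* Let $G$ be a locally compact second countable (lcsc) group with a left-invariant proper metric $d_G$, and let $(M_i)_{i=1}^\infty$ be a sequence of nonempty local $G$-spaces. Then the following are equivalent. 1. $(M_i)_{i=1}^\infty$ is a sofic approximation to $G$. 2. $\mathrm{vol}_{M_i}(M_i)<\infty$ for every $i$, and for every $\rho>0$, $$\lim_{i\to\infty}\frac{\mathrm{vol}_{M_i}(\{p\in M_i:\ \mathrm{injrad}(M_i,p)>\rho\})}{\mathrm{vol}_{M_i}(M_i)}=1.$$
   Context: lcsc means locally compact, second countable (and Hausdorff). A proper metric on $G$ is one inducing the topology of $G$ and whose closed balls are compact. Local $G$-spaces. A partial right-action of $G$ on a Hausdorff space $M$ is a continuous map $\alpha:\mathrm{dom}(\alpha)\to M$, with $\mathrm{dom}(\alpha)\subset M\times G$ open, such that for all $p\in M$ and $g,h\in G$: (1) $(p,1_G)\in \mathrm{dom}(\alpha)$ and $\alpha(p,1_G)=p$; (2) if $(p,g)\in\mathrm{dom}(\alpha)$ then $(\alpha(p,g),g^{-1})\in\mathrm{dom}(\alpha)$ and $\alpha(\alpha(p,g),g^{-1})=p$; (3) if $(p,g),(\alpha(p,g),h),(p,gh)\in\mathrm{dom}(\alpha)$ then $\alpha(p,gh)=\alpha(\alpha(p,g),h)$. It is homogeneous if moreover (4) for every $p\in M$ there is an open neighborhood $O_p$ of $1_G$ in $G$ such that $\{p\}\times O_p\subset\mathrm{dom}(\alpha)$ and $g\mapsto\alpha(p,g)$ restricted to $O_p$ is a homeomorphism onto an open neighborhood of $p$ in $M$. A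 local $G$-space is a pair $(M,\alpha)$ with $M$ an lcsc space and $\alpha$ a partial homogeneous right-action of $G$ on $M$. Write $p.g=\alpha(p,g)$ (well-defined when $(p,g)\in\mathrm{dom}(\alpha)$) and $p.g.h=(p.g).h$. Injectivity radius. Let $B(\rho)\subset G$ be the open ball of radius $\rho$ centered at $1_G$ for $d_G$. For a local $G$-space $M$ and $p\in M$, $\mathrm{injrad}(M,p)$ is the supremum over all $\rho>0$ such that (a) for any $g,h\in G$ with $g,h,gh\in B(\rho)$, $p.g.h=p.gh$ (in particular both sides are well-defined); and (b) the restriction of $\alpha(p,\cdot)$ to $B(\rho)$ is a homeomorphism onto its image. Charts and the canonical measure. A chart centered at $p\in M$ is a homeomorphism $f_p:\mathrm{dom}(f_p)\to\mathrm{rng}(f_p)$ from an open neighborhood of $p$ in $M$ onto an open neighborhood of $1_G$ in $G$ with $f_p(p.g)=g$ for all $g\in\mathrm{rng}(f_p)$. Fix a left-Haar measure $\mathrm{Haar}_G$ on $G$. $\mathrm{vol}_M$ denotes the unique Radon measure on $M$ such that $\mathrm{vol}_M(K)=\mathrm{Haar}_G(f_p(K))$ whenever $f_p$ is a chart and $K\subset\mathrm{dom}(f_p)$ is Borel. Sofic approximations. For $U\subset G$ open and pre-compact, $M[U]$ is the set of all $p\in M$ such that (i) whenever $g,h\in G$ satisfy $g,h,gh\in U$, then $p.g.h=p.gh$ (in particular both sides are well-defined), and (ii) $g\mapsto p.g$ is a homeomorphism from $U$ to an open neighborhood of $p$. For $\epsilon>0$, $M$ is a $(U,\epsilon)$-sofic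 approximation to $G$ if $\mathrm{vol}_M(M)<\infty$ and $\mathrm{vol}_M(M[U])\ge(1-\epsilon)\mathrm{vol}_M(M)$. A sofic approximation to $G$ is a sequence $(M_i)_{i=1}^\infty$ where $M_i$ is a $(U_i,\epsilon_i)$-sofic approximation, the $U_i$ are pre-compact open sets increasing to $G$, and $\epsilon_i$ decreases to $0$. *)

theory Defs
  imports "HOL-Algebra.Coset" "HOL-Analysis.Analysis"
begin

section \<open>Groups, metrics and measures\<close>

definition lcsc_space :: "'a topology \<Rightarrow> bool" where
  "lcsc_space X \<longleftrightarrow> locally_compact_space X \<and> second_countable X \<and> Hausdorff_space X"

definition topological_group :: "('g, 'b) monoid_scheme \<Rightarrow> 'g topology \<Rightarrow> bool" where
  "topological_group G T \<longleftrightarrow>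
     group G \<and> topspace T = carrier G \<and>
     continuous_map (prod_topology T T) T (\<lambda>(x, y). x \<otimes>\<^bsub>G\<^esub> y) \<and>
     continuous_map T T (\<lambda>x. inv\<^bsub>G\<^esub> x)"

definition lcsc_group :: "('g, 'b) monoid_scheme \<Rightarrow> 'g topology \<Rightarrow> bool" where
  "lcsc_group G T \<longleftrightarrow> topological_group G T \<and> lcsc_space T"

definition left_invariant_proper_metric ::
  "('g, 'b) monoid_scheme \<Rightarrow> 'g topology \<Rightarrow> ('g \<Rightarrow> 'g \<Rightarrow> real) \<Rightarrow> bool" where
  "left_invariant_proper_metric G T d \<longleftrightarrow>
     Metric_space (carrier G) d \<and>
     Metric_space.mtopology (carrier G) d = T \<and>
     (\<forall>x\<in>carrier G. \<forall>r. compactin T (Metric_space.mcball (carrier G) d x r)) \<and>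
     (\<forall>g\<in>carrier G. \<forall>x\<in>carrier G. \<forall>y\<in>carrier G. d (g \<otimes>\<^bsub>G\<^esub> x) (g \<otimes>\<^bsub>G\<^esub> y) = d x y)"

text \<open>Radon means: Borel, locally finite, and inner regular with respect to compact sets.\<close>

definition radon_measure :: "'a topology \<Rightarrow> 'a measure \<Rightarrow> bool" where
  "radon_measure X \<mu> \<longleftrightarrow>
     space \<mu> = topspace X \<and>
     sets \<mu> = sigma_sets (topspace X) {U. openin X U} \<and>
     (\<forall>x\<in>topspace X. \<exists>U. openin X U \<and> x \<in> U \<and> emeasure \<mu> U < \<infinity>) \<and>
     (\<forall>A\<in>sets \<mu>. emeasure \<mu> A = (SUP K\<in>{K. compactin X K \<and> K \<subseteq> A}. emeasure \<mu> K))"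

definition left_haar_measure :: "('g, 'b) monoid_scheme \<Rightarrow> 'g topology \<Rightarrow> 'g measure \<Rightarrow> bool" where
  "left_haar_measure G T \<mu> \<longleftrightarrow>
     radon_measure T \<mu> \<and> emeasure \<mu> (carrier G) \<noteq> 0 \<and>
     (\<forall>g\<in>carrier G. \<forall>A\<in>sets \<mu>. emeasure \<mu> (g <#\<^bsub>G\<^esub> A) = emeasure \<mu> A)"


section \<open>Local G-spaces\<close>

text \<open>
  The partial action \<open>\<alpha> : dom(\<alpha>) \<rightarrow> M\<close> is represented by the set \<open>act_dom M = dom(\<alpha>)\<close> and a
  total function \<open>act M\<close> whose values outside \<open>act_dom M\<close> are irrelevant: every use of
  \<open>act M p g\<close> below is accompanied by the requirement \<open>(p, g) \<in> act_dom M\<close>.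
\<close>

record ('m, 'g) local_space =
  top_of :: "'m topology"
  act_dom :: "('m \<times> 'g) set"
  act :: "'m \<Rightarrow> 'g \<Rightarrow> 'm"

abbreviation pts :: "('m, 'g) local_space \<Rightarrow> 'm set" where
  "pts M \<equiv> topspace (top_of M)"

definition partial_right_action ::
  "('g, 'b) monoid_scheme \<Rightarrow> 'g topology \<Rightarrow> ('m, 'g) local_space \<Rightarrow> bool" where
  "partial_right_action G T M \<longleftrightarrow>
     Hausdorff_space (top_of M) \<and>
     openin (prod_topology (top_of M) T) (act_dom M) \<and>
     continuous_map (subtopology (prod_topology (top_of M) T) (act_dom M)) (top_of M)
       (\<lambda>(p, g). act M p g) \<and>
     (\<forall>p\<in>pts M. (p, \<one>\<^bsub>G\<^esub>) \<in> act_dom M \<and> act M p \<one>\<^bsub>G\<^esub> = p) \<and>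
     (\<forall>p\<in>pts M. \<forall>g\<in>carrier G. (p, g) \<in> act_dom M \<longrightarrow>
        (act M p g, inv\<^bsub>G\<^esub> g) \<in> act_dom M \<and> act M (act M p g) (inv\<^bsub>G\<^esub> g) = p) \<and>
     (\<forall>p\<in>pts M. \<forall>g\<in>carrier G. \<forall>h\<in>carrier G.
        (p, g) \<in> act_dom M \<and> (act M p g, h) \<in> act_dom M \<and> (p, g \<otimes>\<^bsub>G\<^esub> h) \<in> act_dom M \<longrightarrow>
        act M p (g \<otimes>\<^bsub>G\<^esub> h) = act M (act M p g) h)"

text \<open>\<open>g \<mapsto> p.g\<close> is defined on \<open>U\<close> and is a homeomorphism from \<open>U\<close> onto its image.\<close>

definition orbit_embedding :: "'g topology \<Rightarrow> ('m, 'g) local_space \<Rightarrow> 'm \<Rightarrow> 'g set \<Rightarrow> bool" where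
  "orbit_embedding T M p U \<longleftrightarrow>
     {p} \<times> U \<subseteq> act_dom M \<and> embedding_map (subtopology T U) (top_of M) (act M p)"

definition homogeneous_action ::
  "('g, 'b) monoid_scheme \<Rightarrow> 'g topology \<Rightarrow> ('m, 'g) local_space \<Rightarrow> bool" where
  "homogeneous_action G T M \<longleftrightarrow>
     (\<forall>p\<in>pts M. \<exists>O'. openin T O' \<and> \<one>\<^bsub>G\<^esub> \<in> O' \<and> orbit_embedding T M p O' \<and>
        openin (top_of M) (act M p ` O') \<and> p \<in> act M p ` O')"

definition local_G_space ::
  "('g, 'b) monoid_scheme \<Rightarrow> 'g topology \<Rightarrow> ('m, 'g) local_space \<Rightarrow> bool" where
  "local_G_space G T M \<longleftrightarrow>
     lcsc_space (top_of M) \<and> partial_right_action G T M \<and> homogeneous_action G T M"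

text \<open>Whenever \<open>g\<close>, \<open>h\<close>, \<open>gh\<close> lie in \<open>U\<close>, both \<open>p.g.h\<close> and \<open>p.gh\<close> are defined, and they agree.\<close>

definition multiplicative_on ::
  "('g, 'b) monoid_scheme \<Rightarrow> ('m, 'g) local_space \<Rightarrow> 'm \<Rightarrow> 'g set \<Rightarrow> bool" where
  "multiplicative_on G M p U \<longleftrightarrow>
     (\<forall>g\<in>U. \<forall>h\<in>U. g \<otimes>\<^bsub>G\<^esub> h \<in> U \<longrightarrow>
        (p, g) \<in> act_dom M \<and> (act M p g, h) \<in> act_dom M \<and> (p, g \<otimes>\<^bsub>G\<^esub> h) \<in> act_dom M \<and>
        act M (act M p g) h = act M p (g \<otimes>\<^bsub>G\<^esub> h))"

definition injrad ::
  "('g, 'b) monoid_scheme \<Rightarrow> 'g topology \<Rightarrow> ('g \<Rightarrow> 'g \<Rightarrow> real) \<Rightarrow> ('m, 'g) local_space \<Rightarrow> 'm \<Rightarrow> ereal"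
  where
  "injrad G T d M p = Sup {ereal \<rho> | \<rho>. \<rho> > 0 \<and>
     multiplicative_on G M p (Metric_space.mball (carrier G) d \<one>\<^bsub>G\<^esub> \<rho>) \<and>
     orbit_embedding T M p (Metric_space.mball (carrier G) d \<one>\<^bsub>G\<^esub> \<rho>)}"


section \<open>Charts and the canonical measure\<close>

text \<open>\<open>f\<close>, restricted to \<open>D\<close>, is a chart centered at \<open>p\<close>; here \<open>dom(f) = D\<close> and \<open>rng(f) = f ` D\<close>.\<close>

definition chart_at ::
  "('g, 'b) monoid_scheme \<Rightarrow> 'g topology \<Rightarrow> ('m, 'g) local_space \<Rightarrow> 'm \<Rightarrow> 'm set \<Rightarrow> ('m \<Rightarrow> 'g) \<Rightarrow> bool"
  where
  "chart_at G T M p D f \<longleftrightarrow>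
     openin (top_of M) D \<and> p \<in> D \<and> openin T (f ` D) \<and> \<one>\<^bsub>G\<^esub> \<in> f ` D \<and>
     homeomorphic_map (subtopology (top_of M) D) (subtopology T (f ` D)) f \<and>
     (\<forall>g\<in>f ` D. (p, g) \<in> act_dom M \<and> act M p g \<in> D \<and> f (act M p g) = g)"

definition vol_measure ::
  "('g, 'b) monoid_scheme \<Rightarrow> 'g topology \<Rightarrow> 'g measure \<Rightarrow> ('m, 'g) local_space \<Rightarrow> 'm measure" where
  "vol_measure G T haar M =
     (THE \<nu>. radon_measure (top_of M) \<nu> \<and>
        (\<forall>p D f K. chart_at G T M p D f \<and> K \<in> sets \<nu> \<and> K \<subseteq> D \<longrightarrow>
           emeasure \<nu> K = emeasure haar (f ` K)))"


section \<open>Sofic approximations\<close>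

text \<open>The set \<open>M[U]\<close>.\<close>

definition sofic_points ::
  "('g, 'b) monoid_scheme \<Rightarrow> 'g topology \<Rightarrow> ('m, 'g) local_space \<Rightarrow> 'g set \<Rightarrow> 'm set" where
  "sofic_points G T M U =
     {p \<in> pts M. multiplicative_on G M p U \<and> orbit_embedding T M p U \<and>
        openin (top_of M) (act M p ` U) \<and> p \<in> act M p ` U}"

text \<open>
  Since the total volume is required to be finite, the real-valued \<^const>\<open>measure\<close> may be used in
  the inequality; it also makes sense for \<open>\<epsilon> > 1\<close>.
\<close>

definition sofic_approx_within ::
  "('g, 'b) monoid_scheme \<Rightarrow> 'g topology \<Rightarrow> 'g measure \<Rightarrow> 'g set \<Rightarrow> real \<Rightarrow> ('m, 'g) local_space \<Rightarrow> bool"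
  where
  "sofic_approx_within G T haar U \<epsilon> M \<longleftrightarrow>
     emeasure (vol_measure G T haar M) (pts M) < \<infinity> \<and>
     measure (vol_measure G T haar M) (sofic_points G T M U)
       \<ge> (1 - \<epsilon>) * measure (vol_measure G T haar M) (pts M)"

definition sofic_approximation ::
  "('g, 'b) monoid_scheme \<Rightarrow> 'g topology \<Rightarrow> 'g measure \<Rightarrow> (nat \<Rightarrow> ('m, 'g) local_space) \<Rightarrow> bool" where
  "sofic_approximation G T haar M \<longleftrightarrow>
     (\<exists>(U :: nat \<Rightarrow> 'g set) (\<epsilon> :: nat \<Rightarrow> real).
        (\<forall>i. openin T (U i) \<and> compactin T (T closure_of (U i))) \<and>
        incseq U \<and> (\<Union>i. U i) = carrier G \<and>
        (\<forall>i. \<epsilon> i > 0) \<and> decseq \<epsilon> \<and> \<epsilon> \<longlonglongrightarrow> 0 \<and>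
        (\<forall>i. sofic_approx_within G T haar (U i) (\<epsilon> i) (M i)))"

end

theory Submission
  imports Defs
begin

text \<open>
  Homogeneity makes every orbit map \<open>g \<mapsto> p.g\<close> open, so the embedding conditions in \<open>M[U]\<close> and in the
  injectivity radius reduce to injectivity. Hence \<open>M[B(\<rho>)]\<close> consists of the points that are
  multiplicative and injective on \<open>B(\<rho>)\<close>; it contains \<open>{injrad > \<rho>}\<close>, while
  \<open>M[U] \<subseteq> {injrad > \<rho>}\<close> once \<open>U\<close> contains a closed ball of radius larger than \<open>\<rho>\<close>, which by
  compactness holds for all late members of an exhaustion. One implication is then a squeeze, the other
  a diagonal choice of radii tending to infinity.

  Two points need care. First, the sets whose volume is taken must be Borel: for compact \<open>K\<close>, being
  multiplicative and injective on \<open>K\<close> is an open condition on the point, and both sets above are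
  countable unions or intersections of such sets for closed balls \<open>K\<close>. Second, the canonical measure must
  exist and have positive total mass: charts differ locally by left translations, so pulling back Haar
  measure through countably many charts and gluing gives a Radon measure, which is the only one possible.
\<close>

section \<open>Local G-spaces\<close>

lemma compactin_tube:
  assumes K: "compactin Y K" and p: "p \<in> topspace X"
    and loc: "\<And>y. y \<in> K \<Longrightarrow> \<exists>N V. openin X N \<and> p \<in> N \<and> openin Y V \<and> y \<in> V \<and> (\<forall>q\<in>N. \<forall>z\<in>V. P q z)"
  shows "\<exists>N. openin X N \<and> p \<in> N \<and> (\<forall>q\<in>N. \<forall>z\<in>K. P q z)"
proof -
  obtain N V where NV: "\<And>y. y \<in> K \<Longrightarrow> openin X (N y) \<and> p \<in> N y \<and> openin Y (V y) \<and> y \<in> V y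
      \<and> (\<forall>q\<in>N y. \<forall>z\<in>V y. P q z)"
    using loc by metis
  have "\<forall>U\<in>V ` K. openin Y U" "K \<subseteq> \<Union>(V ` K)"
    using NV by auto
  then have "\<exists>\<F>. finite \<F> \<and> \<F> \<subseteq> V ` K \<and> K \<subseteq> \<Union>\<F>"
    using K unfolding compactin_def by blast
  then obtain F where F: "finite F" "F \<subseteq> K" "K \<subseteq> \<Union>(V ` F)"
    by (metis finite_subset_image)
  \<comment> \<open>Intersecting with \<open>topspace X\<close> covers the case of an empty
    \<open>F\<close>, where the big intersection is the whole type.\<close>
  have "openin X (topspace X \<inter> \<Inter>(N ` F))"
    using F NV by (cases "F = {}") (auto intro!: openin_Int openin_Inter)
  moreover have "p \<in> topspace X \<inter> \<Inter>(N ` F)"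
    using F NV p by auto
  moreover have "P q z" if "q \<in> topspace X \<inter> \<Inter>(N ` F)" "z \<in> K" for q z
    using that F NV by blast
  ultimately show ?thesis
    by blast
qed

text \<open>Second countability makes \<open>S\<close> Lindelof, so countably many good
  neighbourhoods suffice. With \<open>S\<close> nonempty the subcover is nonempty and can be
  enumerated by \<open>nat\<close>, repetitions allowed.\<close>

lemma Lindelof_local_property:
  assumes X: "second_countable X" and S: "S \<subseteq> topspace X" "S \<noteq> {}"
    and loc: "\<And>x. x \<in> S \<Longrightarrow> \<exists>N. openin X N \<and> x \<in> N \<and> P N"
  shows "\<exists>N :: nat \<Rightarrow> 'a set. (\<forall>n. openin X (N n) \<and> P (N n)) \<and> S \<subseteq> (\<Union>n. N n)"
proof -
  have "Lindelof_space (subtopology X S)"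
    by (simp add: X second_countable_imp_Lindelof_space second_countable_subtopology)
  then have "\<exists>\<V>. countable \<V> \<and> \<V> \<subseteq> {N. openin X N \<and> P N} \<and> S \<subseteq> \<Union>\<V>"
    unfolding Lindelof_space_subtopology_subset[OF S(1)] using loc
    by (elim allE[of _ "{N. openin X N \<and> P N}"]) blast
  then obtain \<V> where V: "countable \<V>" "\<V> \<subseteq> {N. openin X N \<and> P N}" "S \<subseteq> \<Union>\<V>"
    by blast
  then have "\<V> \<noteq> {}"
    using S by auto
  then obtain N :: "nat \<Rightarrow> 'a set" where N: "range N = \<V>"
    using range_from_nat_into[OF _ V(1)] by metis
  then have "N n \<in> \<V>" for n
    by blast
  then have "\<forall>n. openin X (N n) \<and> P (N n)"
    using V(2) by blast
  then show ?thesis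
    using V(3) N by metis
qed

lemma embedding_map_open_image:
  assumes "embedding_map (subtopology T U) X f" "openin T U" "openin X (f ` U)"
    and V: "openin T V" "V \<subseteq> U"
  shows "openin X (f ` V)"
proof -
  have U: "U \<subseteq> topspace T"
    using assms openin_subset by auto
  have "homeomorphic_map (subtopology T U) (subtopology X (f ` U)) f"
    using assms(1) U by (simp add: embedding_map_def Int_absorb1)
  then have "openin (subtopology X (f ` U)) (f ` V)"
    using V by (meson assms(2) homeomorphic_imp_open_map open_map_def openin_open_subtopology)
  then show ?thesis
    using assms(3) by (simp add: openin_open_subtopology)
qed

section \<open>Topological groups, with continuity in neighbourhood form\<close>

locale lcsc_topological_group =
  fixes G :: "('g, 'b) monoid_scheme" (structure)
    and T :: "'g topology"
  assumes lcsc_group: "lcsc_group G T"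
begin

lemma topspace_group [simp]: "topspace T = carrier G"
  using lcsc_group by (simp add: lcsc_group_def topological_group_def)

sublocale group G
  using lcsc_group by (simp add: lcsc_group_def topological_group_def)

lemma Hausdorff_group: "Hausdorff_space T" and second_countable_group: "second_countable T"
  using lcsc_group by (simp_all add: lcsc_group_def lcsc_space_def)

lemma mult_nhds:
  assumes "g \<in> carrier G" "h \<in> carrier G" and W: "openin T W" "g \<otimes> h \<in> W"
  obtains V V' where "openin T V" "g \<in> V" "openin T V'" "h \<in> V'"
    "\<And>x y. \<lbrakk>x \<in> V; y \<in> V'\<rbrakk> \<Longrightarrow> x \<otimes> y \<in> W"
proof -
  have "continuous_map (prod_topology T T) T (\<lambda>(x, y). x \<otimes> y)"
    using lcsc_group by (simp add: lcsc_group_def topological_group_def)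
  from openin_continuous_map_preimage[OF this W(1), unfolded openin_prod_topology_alt, rule_format, of g h] assms
  obtain V V' where "openin T V" "openin T V'" "g \<in> V" "h \<in> V'"
    "V \<times> V' \<subseteq> {x \<in> topspace (prod_topology T T). (case x of (x, y) \<Rightarrow> x \<otimes> y) \<in> W}"
    by auto
  then show ?thesis
    by (intro that[of V V']) auto
qed

lemma inv_nhds:
  assumes "g \<in> carrier G" and W: "openin T W" "inv g \<in> W"
  obtains V where "openin T V" "g \<in> V" "\<And>x. x \<in> V \<Longrightarrow> inv x \<in> W"
proof -
  have "continuous_map T T (\<lambda>x. inv x)"
    using lcsc_group by (simp add: lcsc_group_def topological_group_def)
  from openin_continuous_map_preimage[OF this W(1)] show ?thesis
    using that assms by fastforce
qed

end

section \<open>The partial action near a point: orbit maps are open and locally free\<close>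

locale local_space = lcsc_topological_group G T
  for G :: "('g, 'b) monoid_scheme" (structure)
    and T :: "'g topology" +
  fixes M :: "('m, 'g) local_space"
  assumes local_G_space: "local_G_space G T M"
begin

lemma Hausdorff_pts: "Hausdorff_space (top_of M)" and second_countable_pts: "second_countable (top_of M)"
  using local_G_space by (simp_all add: local_G_space_def lcsc_space_def)

lemma act_dom_open: "openin (prod_topology (top_of M) T) (act_dom M)"
  using local_G_space by (simp add: local_G_space_def partial_right_action_def)

lemma act_domD: "(p, g) \<in> act_dom M \<Longrightarrow> p \<in> pts M \<and> g \<in> carrier G"
  using openin_subset[OF act_dom_open] by auto

lemma act_one: "p \<in> pts M \<Longrightarrow> (p, \<one>) \<in> act_dom M \<and> act M p \<one> = p"
  using local_G_space by (simp add: local_G_space_def partial_right_action_def)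

lemma act_inv: "(p, g) \<in> act_dom M \<Longrightarrow> (act M p g, inv g) \<in> act_dom M \<and> act M (act M p g) (inv g) = p"
  using local_G_space act_domD[of p g] by (simp add: local_G_space_def partial_right_action_def)

lemma act_pts: "(p, g) \<in> act_dom M \<Longrightarrow> act M p g \<in> pts M"
  using act_inv act_domD by blast

lemma act_mult:
  "\<lbrakk>(p, g) \<in> act_dom M; (act M p g, h) \<in> act_dom M; (p, g \<otimes> h) \<in> act_dom M\<rbrakk>
    \<Longrightarrow> act M p (g \<otimes> h) = act M (act M p g) h"
  using local_G_space act_domD[of p g] act_domD[of "act M p g" h]
  by (simp add: local_G_space_def partial_right_action_def)

lemma homogeneous:
  assumes "p \<in> pts M"
  obtains U where "openin T U" "\<one> \<in> U" "orbit_embedding T M p U" "openin (top_of M) (act M p ` U)"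
    "p \<in> act M p ` U"
  using local_G_space assms unfolding local_G_space_def homogeneous_action_def by blast

lemma act_nhds:
  assumes pg: "(p, g) \<in> act_dom M" and W: "openin (top_of M) W" "act M p g \<in> W"
  obtains N V where "openin (top_of M) N" "p \<in> N" "openin T V" "g \<in> V"
    "\<And>q h. \<lbrakk>q \<in> N; h \<in> V\<rbrakk> \<Longrightarrow> (q, h) \<in> act_dom M \<and> act M q h \<in> W"
proof -
  let ?A = "{x \<in> act_dom M. (case x of (p, g) \<Rightarrow> act M p g) \<in> W}"
  have "continuous_map (subtopology (prod_topology (top_of M) T) (act_dom M)) (top_of M) (\<lambda>(p, g). act M p g)"
    using local_G_space by (simp add: local_G_space_def partial_right_action_def)
  then have "openin (subtopology (prod_topology (top_of M) T) (act_dom M)) ?A"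
    by (rule openin_continuous_map_preimage_gen) (simp_all add: act_dom_open openin_open_subtopology W)
  then have "openin (prod_topology (top_of M) T) ?A"
    by (simp add: act_dom_open openin_open_subtopology)
  from this[unfolded openin_prod_topology_alt, rule_format, of p g] pg W(2)
  obtain N V where "openin (top_of M) N" "openin T V" "p \<in> N" "g \<in> V" "N \<times> V \<subseteq> ?A"
    by auto
  then show ?thesis
    by (intro that[of N V]) auto
qed

lemma act_dom_nhds:
  assumes "(p, g) \<in> act_dom M"
  obtains N V where "openin (top_of M) N" "p \<in> N" "openin T V" "g \<in> V" "N \<times> V \<subseteq> act_dom M"
proof (rule act_nhds[OF assms openin_topspace act_pts[OF assms]])
qed (use that in blast)

lemma continuous_orbit:
  assumes "{p} \<times> U \<subseteq> act_dom M"
  shows "continuous_map (subtopology T U) (top_of M) (act M p)"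
  unfolding continuous_map_def
proof (intro conjI allI impI)
  have U: "U \<subseteq> carrier G"
    using assms act_domD by blast
  show "act M p \<in> topspace (subtopology T U) \<rightarrow> pts M"
    using assms act_pts by auto
  fix W assume W: "openin (top_of M) W"
  let ?S = "{x \<in> topspace (subtopology T U). act M p x \<in> W}"
  show "openin (subtopology T U) ?S"
  proof (subst openin_subopen, intro ballI)
    fix x assume x: "x \<in> ?S"
    then have "(p, x) \<in> act_dom M" "act M p x \<in> W"
      using assms by auto
    from act_nhds[OF this(1) W this(2)] obtain N V where
      NV: "p \<in> N" "openin T V" "x \<in> V" "\<And>q h. \<lbrakk>q \<in> N; h \<in> V\<rbrakk> \<Longrightarrow> (q, h) \<in> act_dom M \<and> act M q h \<in> W"
      by metis
    then have "V \<inter> U \<subseteq> ?S"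
      using U by auto
    then show "\<exists>V. openin (subtopology T U) V \<and> x \<in> V \<and> V \<subseteq> ?S"
      using x NV openin_subtopology_Int by (intro exI[of _ "V \<inter> U"]) auto
  qed
qed

text \<open>Homogeneity is applied at \<open>x = p.g\<close> rather than at \<open>p\<close>: the
  points \<open>x.k\<close> with \<open>k\<close> near 1 fill a neighbourhood of \<open>x\<close>,
  and \<open>x.k = p.(gk)\<close> remains in the image because \<open>U\<close> is open. Injectivity
  of the orbit map on \<open>U\<close> does not enter.\<close>

lemma orbit_open:
  assumes dom: "{p} \<times> U \<subseteq> act_dom M" and U: "openin T U"
  shows "openin (top_of M) (act M p ` U)"
proof (subst openin_subopen, intro ballI)
  fix x assume "x \<in> act M p ` U"
  then obtain g where g: "g \<in> U" "x = act M p g"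
    by blast
  then have pg: "(p, g) \<in> act_dom M" and x: "x \<in> pts M" and gG: "g \<in> carrier G"
    using dom act_pts act_domD by blast+
  obtain W where W: "openin T W" "\<one> \<in> W" "orbit_embedding T M x W" "openin (top_of M) (act M x ` W)"
    using homogeneous[OF x] by metis
  obtain V V' where V: "g \<in> V" "openin T V'" "\<one> \<in> V'" "\<And>x y. \<lbrakk>x \<in> V; y \<in> V'\<rbrakk> \<Longrightarrow> x \<otimes> y \<in> U"
    using mult_nhds[OF gG one_closed U] g(1) r_one[OF gG] by metis
  have "openin (top_of M) (act M x ` (V' \<inter> W))"
    by (rule embedding_map_open_image[of T W]) (use W V in \<open>auto simp: orbit_embedding_def\<close>)
  moreover have "x \<in> act M x ` (V' \<inter> W)"
    using act_one[OF x] V W by force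
  moreover have "act M x ` (V' \<inter> W) \<subseteq> act M p ` U"
  proof
    fix y assume "y \<in> act M x ` (V' \<inter> W)"
    then obtain k where k: "k \<in> V'" "k \<in> W" "y = act M x k"
      by blast
    then have "(x, k) \<in> act_dom M" "g \<otimes> k \<in> U" "(p, g \<otimes> k) \<in> act_dom M"
      using W V dom by (auto simp: orbit_embedding_def)
    then show "y \<in> act M p ` U"
      using k g act_mult[OF pg, of k] by force
  qed
  ultimately show "\<exists>S. openin (top_of M) S \<and> x \<in> S \<and> S \<subseteq> act M p ` U"
    by blast
qed

text \<open>The orbit map is continuous by \<open>continuous_orbit\<close> and open by
  \<open>orbit_open\<close>, so being an embedding is a matter of injectivity alone.\<close>

lemma orbit_embedding_iff:
  assumes U: "openin T U"
  shows "orbit_embedding T M p U \<longleftrightarrow> {p} \<times> U \<subseteq> act_dom M \<and> inj_on (act M p) U"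
proof -
  have top: "topspace (subtopology T U) = U"
    using openin_subset[OF U] by auto
  show ?thesis
  proof
    assume "orbit_embedding T M p U"
    then show "{p} \<times> U \<subseteq> act_dom M \<and> inj_on (act M p) U"
      using top by (metis embedding_map_def homeomorphic_imp_injective_map orbit_embedding_def)
  next
    assume *: "{p} \<times> U \<subseteq> act_dom M \<and> inj_on (act M p) U"
    have "open_map (subtopology T U) (top_of M) (act M p)"
      unfolding open_map_def openin_open_subtopology[OF U] using * by (auto intro: orbit_open)
    then have "embedding_map (subtopology T U) (top_of M) (act M p)"
      using * continuous_orbit by (intro injective_open_imp_embedding_map) (auto intro: inj_on_subset)
    then show "orbit_embedding T M p U"
      using * by (simp add: orbit_embedding_def)
  qed
qed

text \<open>Points near \<open>p\<close> are \<open>p.a\<close> with \<open>a\<close> near \<open>1\<close>, and there \<open>p.a.k = p.a\<close> reads \<open>p.(ak) = p.a\<close>.\<close>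

lemma locally_free:
  assumes p: "p \<in> pts M"
  obtains N V where "openin (top_of M) N" "p \<in> N" "openin T V" "\<one> \<in> V"
    "\<And>q k. \<lbrakk>q \<in> N; k \<in> V; act M q k = q\<rbrakk> \<Longrightarrow> k = \<one>"
proof -
  obtain W where W: "openin T W" "\<one> \<in> W" "orbit_embedding T M p W" "openin (top_of M) (act M p ` W)"
    using homogeneous[OF p] by metis
  then have dom: "{p} \<times> W \<subseteq> act_dom M" and inj: "inj_on (act M p) W"
    using orbit_embedding_iff by blast+
  obtain V1 V2 where V: "openin T V1" "\<one> \<in> V1" "openin T V2" "\<one> \<in> V2"
    "\<And>x y. \<lbrakk>x \<in> V1; y \<in> V2\<rbrakk> \<Longrightarrow> x \<otimes> y \<in> W"
    using mult_nhds[OF one_closed one_closed W(1)] W(2) r_one[OF one_closed] by metis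
  obtain N1 V3 where N1: "openin (top_of M) N1" "p \<in> N1" "openin T V3" "\<one> \<in> V3" "N1 \<times> V3 \<subseteq> act_dom M"
    using act_dom_nhds act_one[OF p] by metis
  let ?N = "act M p ` (V1 \<inter> W) \<inter> N1"
  have "openin (top_of M) (act M p ` (V1 \<inter> W))"
    using dom V W by (intro orbit_open) auto
  moreover have "p \<in> act M p ` (V1 \<inter> W)"
    using act_one[OF p] V W by force
  moreover have "k = \<one>" if q: "q \<in> ?N" "k \<in> V2 \<inter> V3" "act M q k = q" for q k
  proof -
    obtain a where a: "a \<in> V1" "a \<in> W" "q = act M p a"
      using q by blast
    then have akW: "a \<otimes> k \<in> W" and G: "a \<in> carrier G" "k \<in> carrier G"
      using q V openin_subset by fastforce+
    have "act M p (a \<otimes> k) = act M p a"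
      using act_mult[of p a k] dom a akW q N1 by auto
    then have "a \<otimes> k = a"
      using inj a akW by (meson inj_onD)
    then show ?thesis
      using G by simp
  qed
  ultimately show ?thesis
    by (intro that[of ?N "V2 \<inter> V3"]) (use V N1 in \<open>blast intro: openin_Int\<close>)+
qed

text \<open>The conditions behind \<open>M[U]\<close> and the injectivity radius with the
  topological clauses removed. In this form they make sense for compact sets as well as open ones,
  which is what the Borel arguments use.\<close>

definition regular_pts :: "'g set \<Rightarrow> 'm set" where
  "regular_pts K = {p \<in> pts M. multiplicative_on G M p K \<and> {p} \<times> K \<subseteq> act_dom M \<and> inj_on (act M p) K}"

lemma regular_pts_mono: "K \<subseteq> L \<Longrightarrow> regular_pts L \<subseteq> regular_pts K"
  unfolding regular_pts_def multiplicative_on_def subset_iff by (auto intro: inj_on_subset)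

text \<open>Each clause involves at most three group elements at a time, and monotonicity of
  \<open>K\<close> puts these into a common \<open>K n\<close>.\<close>

lemma regular_pts_INT:
  assumes "incseq K"
  shows "regular_pts (\<Union>n. K n) = (\<Inter>n. regular_pts (K n))"
proof
  show "regular_pts (\<Union>n. K n) \<subseteq> (\<Inter>n. regular_pts (K n))"
    using regular_pts_mono by (metis INT_greatest UN_upper UNIV_I)
  show "(\<Inter>n. regular_pts (K n)) \<subseteq> regular_pts (\<Union>n. K n)"
  proof
    fix p assume p: "p \<in> (\<Inter>n. regular_pts (K n))"
    have common: "\<exists>n. g \<in> K n \<and> h \<in> K n \<and> k \<in> K n"
      if gh: "g \<in> (\<Union>n. K n)" "h \<in> (\<Union>n. K n)" "k \<in> (\<Union>n. K n)" for g h k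
    proof -
      obtain a b c where "g \<in> K a" "h \<in> K b" "k \<in> K c"
        using gh by blast
      then have "g \<in> K (max a (max b c)) \<and> h \<in> K (max a (max b c)) \<and> k \<in> K (max a (max b c))"
        using incseqD[OF assms] by (meson max.cobounded1 max.cobounded2 le_max_iff_disj subsetD)
      then show ?thesis
        by blast
    qed
    have "multiplicative_on G M p (\<Union>n. K n)"
      unfolding multiplicative_on_def
    proof (intro ballI impI)
      fix g h assume "g \<in> (\<Union>n. K n)" "h \<in> (\<Union>n. K n)" "g \<otimes> h \<in> (\<Union>n. K n)"
      from common[OF this] obtain n where "g \<in> K n" "h \<in> K n" "g \<otimes> h \<in> K n"
        by blast
      moreover have "multiplicative_on G M p (K n)"
        using p by (auto simp: regular_pts_def)
      ultimately show "(p, g) \<in> act_dom M \<and> (act M p g, h) \<in> act_dom M \<and> (p, g \<otimes> h) \<in> act_dom M \<and>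
          act M (act M p g) h = act M p (g \<otimes> h)"
        unfolding multiplicative_on_def by blast
    qed
    moreover have "{p} \<times> (\<Union>n. K n) \<subseteq> act_dom M"
      using p by (auto simp: regular_pts_def)
    moreover have "inj_on (act M p) (\<Union>n. K n)"
    proof (rule inj_onI)
      fix g h assume "g \<in> (\<Union>n. K n)" "h \<in> (\<Union>n. K n)" "act M p g = act M p h"
      then show "g = h"
        using common[of g h h] p by (force simp: regular_pts_def dest: inj_onD)
    qed
    ultimately show "p \<in> regular_pts (\<Union>n. K n)"
      using p by (auto simp: regular_pts_def)
  qed
qed

text \<open>Off the diagonal, Hausdorffness separates \<open>p.g\<close> from \<open>p.h\<close>,
  and continuity of the action preserves the separation. On the diagonal, \<open>q.x = q.y\<close>
  makes \<open>y\<close> times the inverse of \<open>x\<close> an element near 1 that fixes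
  \<open>q\<close>, so \<open>locally_free\<close> applies.\<close>

lemma orbit_injective_nhds:
  assumes dom: "(p, g) \<in> act_dom M" "(p, h) \<in> act_dom M" and inj: "act M p g = act M p h \<Longrightarrow> g = h"
  obtains N V V' where "openin (top_of M) N" "p \<in> N" "openin T V" "g \<in> V" "openin T V'" "h \<in> V'"
    "\<And>q x y. \<lbrakk>q \<in> N; x \<in> V; y \<in> V'; act M q x = act M q y\<rbrakk> \<Longrightarrow> x = y"
proof (cases "g = h")
  case False
  then obtain A B where "openin (top_of M) A" "act M p g \<in> A" "openin (top_of M) B" "act M p h \<in> B" "disjnt A B"
    using inj Hausdorff_pts act_pts[OF dom(1)] act_pts[OF dom(2)] unfolding Hausdorff_space_def by metis
  moreover from this obtain N1 V1 where "openin (top_of M) N1" "p \<in> N1" "openin T V1" "g \<in> V1"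
    "\<And>q x. \<lbrakk>q \<in> N1; x \<in> V1\<rbrakk> \<Longrightarrow> (q, x) \<in> act_dom M \<and> act M q x \<in> A"
    using act_nhds[OF dom(1)] by metis
  moreover from calculation obtain N2 V2 where "openin (top_of M) N2" "p \<in> N2" "openin T V2" "h \<in> V2"
    "\<And>q x. \<lbrakk>q \<in> N2; x \<in> V2\<rbrakk> \<Longrightarrow> (q, x) \<in> act_dom M \<and> act M q x \<in> B"
    using act_nhds[OF dom(2)] by metis
  ultimately show ?thesis
    using that[of "N1 \<inter> N2" V1 V2] by (metis IntE IntI disjnt_iff openin_Int)
next
  case True
  have G: "g \<in> carrier G" and p: "p \<in> pts M"
    using act_domD dom by blast+
  obtain N1 V1 where 1: "openin (top_of M) N1" "p \<in> N1" "openin T V1" "\<one> \<in> V1"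
    "\<And>q k. \<lbrakk>q \<in> N1; k \<in> V1; act M q k = q\<rbrakk> \<Longrightarrow> k = \<one>"
    using locally_free[OF p] by metis
  obtain N2 V2 where 2: "openin (top_of M) N2" "p \<in> N2" "openin T V2" "g \<in> V2" "N2 \<times> V2 \<subseteq> act_dom M"
    using act_dom_nhds[OF dom(1)] by metis
  obtain N3 V3 where 3: "openin (top_of M) N3" "p \<in> N3" "openin T V3" "\<one> \<in> V3" "N3 \<times> V3 \<subseteq> act_dom M"
    using act_dom_nhds act_one[OF p] by metis
  \<comment> \<open>The quotient must land in \<open>V1\<close>, where local freeness holds, and in
    \<open>V3\<close>, where it acts on the points near \<open>p\<close>.\<close>
  obtain V4 V5 where 4: "openin T V4" "g \<in> V4" "openin T V5" "inv g \<in> V5"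
    "\<And>x y. \<lbrakk>x \<in> V4; y \<in> V5\<rbrakk> \<Longrightarrow> x \<otimes> y \<in> V1 \<inter> V3"
    using mult_nhds[OF G inv_closed[OF G] openin_Int[OF 1(3) 3(3)]] 1(4) 3(4) r_inv[OF G] by (metis IntI)
  obtain V6 where 6: "openin T V6" "g \<in> V6" "\<And>x. x \<in> V6 \<Longrightarrow> inv x \<in> V5"
    using inv_nhds[of g V5] 4 G by metis
  have "x = y" if q: "q \<in> N1 \<inter> N2 \<inter> N3" "x \<in> V2 \<inter> V6" "y \<in> V2 \<inter> V4" "act M q x = act M q y" for q x y
  proof -
    have G: "x \<in> carrier G" "y \<in> carrier G"
      using q 2(3) openin_subset by fastforce+
    have k: "y \<otimes> inv x \<in> V1 \<inter> V3"
      using q 6(3) 4(5) by blast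
    \<comment> \<open>The right side is defined, and equals \<open>q\<close>, because
      \<open>q.y = q.x\<close> and \<open>inv x\<close> undoes \<open>x\<close>.\<close>
    have "act M q (y \<otimes> inv x) = act M (act M q y) (inv x)"
      using q act_inv[of q x] k 2 3 by (intro act_mult) auto
    also have "\<dots> = q"
      using q act_inv[of q x] 2 by auto
    finally have "y \<otimes> inv x = \<one>"
      using 1(5) k q by blast
    then show "x = y"
      using G by (metis inv_equality inv_inv inv_closed)
  qed
  then show ?thesis
    by (intro that[of "N1 \<inter> N2 \<inter> N3" "V2 \<inter> V6" "V2 \<inter> V4"])
      (use 1 2 3 4 6 True in \<open>blast intro: openin_Int\<close>)+
qed

text \<open>The tube lemma over the compact square of \<open>K\<close> reduces openness to
  persistence near one pair \<open>(g, h)\<close>. If \<open>gh\<close> lies in \<open>K\<close>,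
  openness of \<open>act_dom M\<close> preserves the domain conditions; if not, closedness of
  \<open>K\<close> keeps nearby products outside \<open>K\<close>, so nothing has to be checked.
  Injectivity persists by \<open>orbit_injective_nhds\<close>.\<close>

lemma openin_regular_pts:
  assumes K: "compactin T K"
  shows "openin (top_of M) (regular_pts K)"
proof (subst openin_subopen, intro ballI)
  fix p assume "p \<in> regular_pts K"
  then have p: "p \<in> pts M" and mult: "multiplicative_on G M p K"
    and dom: "{p} \<times> K \<subseteq> act_dom M" and inj: "inj_on (act M p) K"
    by (auto simp: regular_pts_def)
  have KG: "K \<subseteq> carrier G"
    using compactin_subset_topspace[OF K] by simp
  have Kc: "openin T (carrier G - K)"
    using compactin_imp_closedin[OF Hausdorff_group K] by (simp add: closedin_def)
  \<comment> \<open>The equation \<open>q.g.h = q.gh\<close> is left out: it is not an open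
    condition on its face, but \<open>act_mult\<close> yields it once all three domain conditions
    hold.\<close>
  define P where "P q z \<longleftrightarrow> (q, fst z) \<in> act_dom M \<and> (act M q (fst z) = act M q (snd z) \<longrightarrow> fst z = snd z)
      \<and> (fst z \<otimes> snd z \<in> K \<longrightarrow> (act M q (fst z), snd z) \<in> act_dom M \<and> (q, fst z \<otimes> snd z) \<in> act_dom M)" for q z
  have "\<exists>N. openin (top_of M) N \<and> p \<in> N \<and> (\<forall>q\<in>N. \<forall>z\<in>K \<times> K. P q z)"
  proof (rule compactin_tube[where Y = "prod_topology T T"])
    show "compactin (prod_topology T T) (K \<times> K)"
      using K by (simp add: compactin_Times)
    fix z assume "z \<in> K \<times> K"
    then obtain g h where z: "z = (g, h)" and gh: "g \<in> K" "h \<in> K"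
      by blast
    then have G: "g \<in> carrier G" "h \<in> carrier G" and d: "(p, g) \<in> act_dom M" "(p, h) \<in> act_dom M"
      using KG dom by auto
    have inj': "act M p g = act M p h \<Longrightarrow> g = h"
      using inj gh by (meson inj_onD)
    obtain N1 V1 W1 where 1: "openin (top_of M) N1" "p \<in> N1" "openin T V1" "g \<in> V1" "openin T W1" "h \<in> W1"
      "\<And>q x y. \<lbrakk>q \<in> N1; x \<in> V1; y \<in> W1; act M q x = act M q y\<rbrakk> \<Longrightarrow> x = y"
      by (rule orbit_injective_nhds[OF d inj'], assumption) (rule that)
    obtain N2 V2 where 2: "openin (top_of M) N2" "p \<in> N2" "openin T V2" "g \<in> V2" "N2 \<times> V2 \<subseteq> act_dom M"
      using act_dom_nhds[OF d(1)] by metis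
    obtain N3 V3 W3 where 3: "openin (top_of M) N3" "p \<in> N3" "openin T V3" "g \<in> V3" "openin T W3" "h \<in> W3"
      "\<And>q x y. \<lbrakk>q \<in> N3; x \<in> V3; y \<in> W3; x \<otimes> y \<in> K\<rbrakk> \<Longrightarrow> (act M q x, y) \<in> act_dom M \<and> (q, x \<otimes> y) \<in> act_dom M"
    proof (cases "g \<otimes> h \<in> K")
      case False
      then obtain A B where "openin T A" "g \<in> A" "openin T B" "h \<in> B"
        "\<And>x y. \<lbrakk>x \<in> A; y \<in> B\<rbrakk> \<Longrightarrow> x \<otimes> y \<in> carrier G - K"
        using mult_nhds[OF G Kc] G by (metis DiffI m_closed)
      then show thesis
        using that[of "pts M" A B] p by blast
    next
      case True
      then have d2: "(act M p g, h) \<in> act_dom M" "(p, g \<otimes> h) \<in> act_dom M"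
        using mult gh by (auto simp: multiplicative_on_def)
      obtain A B where 4: "openin (top_of M) A" "act M p g \<in> A" "openin T B" "h \<in> B" "A \<times> B \<subseteq> act_dom M"
        using act_dom_nhds[OF d2(1)] by metis
      obtain N5 V5 where 5: "openin (top_of M) N5" "p \<in> N5" "openin T V5" "g \<in> V5"
          "\<And>q x. \<lbrakk>q \<in> N5; x \<in> V5\<rbrakk> \<Longrightarrow> (q, x) \<in> act_dom M \<and> act M q x \<in> A"
        using act_nhds[OF d(1) 4(1) 4(2)] by metis
      obtain N6 C where 6: "openin (top_of M) N6" "p \<in> N6" "openin T C" "g \<otimes> h \<in> C" "N6 \<times> C \<subseteq> act_dom M"
        using act_dom_nhds[OF d2(2)] by metis
      obtain V7 W7 where 7: "openin T V7" "g \<in> V7" "openin T W7" "h \<in> W7"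
        "\<And>x y. \<lbrakk>x \<in> V7; y \<in> W7\<rbrakk> \<Longrightarrow> x \<otimes> y \<in> C"
        using mult_nhds[OF G 6(3) 6(4)] by metis
      show thesis
        by (rule that[of "N5 \<inter> N6" "V5 \<inter> V7" "B \<inter> W7"]) (use 4 5 6 7 in auto)
    qed
    have "\<forall>q\<in>N1 \<inter> N2 \<inter> N3. \<forall>z\<in>(V1 \<inter> V2 \<inter> V3) \<times> (W1 \<inter> W3). P q z"
      using 1 2 3 by (auto simp: P_def)
    moreover have "openin (prod_topology T T) ((V1 \<inter> V2 \<inter> V3) \<times> (W1 \<inter> W3))"
      using 1 2 3 by (simp add: openin_prod_Times_iff openin_Int)
    ultimately show "\<exists>N V. openin (top_of M) N \<and> p \<in> N \<and> openin (prod_topology T T) V \<and> z \<in> V \<and>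
        (\<forall>q\<in>N. \<forall>z\<in>V. P q z)"
      using 1(1-6) 2(1-4) 3(1-6) z
      by (intro exI[of _ "N1 \<inter> N2 \<inter> N3"] exI[of _ "(V1 \<inter> V2 \<inter> V3) \<times> (W1 \<inter> W3)"]) auto
  qed (fact p)
  then obtain N where N: "openin (top_of M) N" "p \<in> N" "\<And>q g h. \<lbrakk>q \<in> N; g \<in> K; h \<in> K\<rbrakk> \<Longrightarrow> P q (g, h)"
    by blast
  have "N \<subseteq> regular_pts K"
  proof
    fix q assume q: "q \<in> N"
    have dom: "(q, g) \<in> act_dom M" if "g \<in> K" for g
      using N(3)[OF q that that] by (simp add: P_def)
    then have "{q} \<times> K \<subseteq> act_dom M"
      by blast
    moreover have "inj_on (act M q) K"
      using N(3)[OF q] by (auto simp: P_def intro: inj_onI)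
    moreover have "multiplicative_on G M q K"
      unfolding multiplicative_on_def using N(3)[OF q] act_mult by (auto simp: P_def)
    ultimately show "q \<in> regular_pts K"
      using q N(1) openin_subset by (fastforce simp: regular_pts_def)
  qed
  then show "\<exists>S. openin (top_of M) S \<and> p \<in> S \<and> S \<subseteq> regular_pts K"
    using N by blast
qed

end

section \<open>Gluing measures on second countable spaces\<close>

text \<open>Countably many of the neighbourhoods cover \<open>S\<close>. Made disjoint, they cut
  \<open>A\<close> into Borel pieces on which the measures agree, and countable additivity sums
  these without any finiteness. This serves for positivity of Haar measure, independence of charts
  and uniqueness of the volume.\<close>

lemma emeasure_eq_locally:
  assumes X: "second_countable X"
    and \<mu>: "space \<mu> = topspace X" "sets \<mu> = sigma_sets (topspace X) {U. openin X U}"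
    and \<nu>: "sets \<nu> = sets \<mu>"
    and S: "openin X S"
    and loc: "\<And>x. x \<in> S \<Longrightarrow> \<exists>N. openin X N \<and> x \<in> N \<and> (\<forall>A\<in>sets \<mu>. A \<subseteq> N \<longrightarrow> emeasure \<mu> A = emeasure \<nu> A)"
    and A: "A \<in> sets \<mu>" "A \<subseteq> S"
  shows "emeasure \<mu> A = emeasure \<nu> A"
proof (cases "S = {}")
  case True
  then show ?thesis
    using A by simp
next
  case False
  have "S \<subseteq> topspace X"
    using S openin_subset by blast
  with Lindelof_local_property[OF X _ False, where P = "\<lambda>N. \<forall>A\<in>sets \<mu>. A \<subseteq> N \<longrightarrow> emeasure \<mu> A = emeasure \<nu> A"] loc
  obtain N :: "nat \<Rightarrow> _" where N: "\<forall>n. openin X (N n) \<and> (\<forall>A\<in>sets \<mu>. A \<subseteq> N n \<longrightarrow> emeasure \<mu> A = emeasure \<nu> A)"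
    and cover: "S \<subseteq> (\<Union>n. N n)"
    by blast
  have "range N \<subseteq> sets \<mu>"
    using N \<mu>(2) by auto
  then have C: "disjointed N n \<in> sets \<mu>" for n
    using sets.range_disjointed_sets[of N \<mu>] by auto
  let ?C = "\<lambda>n. A \<inter> disjointed N n"
  have "disjoint_family ?C"
    using disjoint_family_disjointed[of N] by (auto simp: disjoint_family_on_def)
  moreover have "range ?C \<subseteq> sets \<mu>"
    using C A by auto
  moreover have "(\<Union>n. ?C n) = A"
    unfolding Int_UN_distrib[symmetric] UN_disjointed_eq using cover A(2) by blast
  moreover have "emeasure \<mu> (?C n) = emeasure \<nu> (?C n)" for n
  proof -
    have "?C n \<in> sets \<mu>" "?C n \<subseteq> N n"
      using C A disjointed_subset[of N n] by auto
    then show ?thesis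
      using N by blast
  qed
  ultimately show ?thesis
    using suminf_emeasure[of ?C \<mu>] suminf_emeasure[of ?C \<nu>] \<nu> by simp
qed

text \<open>Tonelli for the counting measure on \<open>nat\<close>.\<close>

lemma suminf_ennreal_swap:
  fixes f :: "nat \<Rightarrow> nat \<Rightarrow> ennreal"
  shows "(\<Sum>i. \<Sum>n. f i n) = (\<Sum>n. \<Sum>i. f i n)"
  using nn_integral_suminf[of "\<lambda>n i. f i n" "count_space UNIV"]
  by (simp add: nn_integral_count_space_nat)

text \<open>The glued measure is the sum of the restrictions of \<open>\<mu> n\<close> to
  \<open>C n\<close>; exchanging the two series gives countable additivity.\<close>

lemma glue_measures:
  fixes \<mu> :: "nat \<Rightarrow> 'a measure"
  assumes \<mu>: "\<And>n. sets (\<mu> n) = sets B" and C: "\<And>n. C n \<in> sets B"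
  obtains \<nu> where "sets \<nu> = sets B" "\<And>A. A \<in> sets B \<Longrightarrow> emeasure \<nu> A = (\<Sum>n. emeasure (\<mu> n) (A \<inter> C n))"
proof
  let ?m = "\<lambda>A. \<Sum>n. emeasure (\<mu> n) (A \<inter> C n)"
  let ?\<nu> = "measure_of (space B) (sets B) ?m"
  show sets: "sets ?\<nu> = sets B"
    by simp
  have "countably_additive (sets B) ?m"
    unfolding countably_additive_def
  proof (intro allI impI)
    fix A :: "nat \<Rightarrow> 'a set"
    assume A: "range A \<subseteq> sets B" "disjoint_family A" "(\<Union>i. A i) \<in> sets B"
    have "(\<Sum>i. emeasure (\<mu> n) (A i \<inter> C n)) = emeasure (\<mu> n) ((\<Union>i. A i) \<inter> C n)" for n
    proof (subst suminf_emeasure)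
      show "range (\<lambda>i. A i \<inter> C n) \<subseteq> sets (\<mu> n)"
        using A C \<mu> by auto
      show "disjoint_family (\<lambda>i. A i \<inter> C n)"
        using A by (auto simp: disjoint_family_on_def)
    qed simp
    then show "(\<Sum>i. ?m (A i)) = ?m (\<Union>i. A i)"
      by (subst suminf_ennreal_swap) simp
  qed
  then show "emeasure ?\<nu> A = ?m A" if "A \<in> sets B" for A
    using that by (intro emeasure_measure_of[OF refl])
      (auto simp: sets positive_def sets.space_closed)
qed

lemma closedin_borel:
  assumes "closedin X A"
  shows "A \<in> sigma_sets (topspace X) {U. openin X U}"
proof -
  have "topspace X - (topspace X - A) \<in> sigma_sets (topspace X) {U. openin X U}"
    using assms by (intro sigma_sets.Compl sigma_sets.Basic) (simp add: closedin_def)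
  moreover have "topspace X - (topspace X - A) = A"
    using closedin_subset[OF assms] by blast
  ultimately show ?thesis
    by simp
qed

text \<open>The compact inner approximation \<open>I\<close> is superadditive on disjoint sets,
  since a union of two compact sets is compact. Regularity thus passes from subsets of single
  \<open>D n\<close> to finite unions by induction, and to all of \<open>A\<close> by continuity
  from below, which is valid for infinite measures too.\<close>

lemma inner_regular_from_cover:
  fixes D :: "nat \<Rightarrow> 'a set"
  assumes X: "Hausdorff_space X"
    and \<nu>: "space \<nu> = topspace X" "sets \<nu> = sigma_sets (topspace X) {U. openin X U}"
    and D: "\<And>n. D n \<in> sets \<nu>" "(\<Union>n. D n) = topspace X"
    and reg: "\<And>n A. \<lbrakk>A \<in> sets \<nu>; A \<subseteq> D n\<rbrakk> \<Longrightarrow> emeasure \<nu> A \<le> (SUP K\<in>{K. compactin X K \<and> K \<subseteq> A}. emeasure \<nu> K)"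
    and A: "A \<in> sets \<nu>"
  shows "emeasure \<nu> A = (SUP K\<in>{K. compactin X K \<and> K \<subseteq> A}. emeasure \<nu> K)"
proof (rule antisym)
  define I where "I A = (SUP K\<in>{K. compactin X K \<and> K \<subseteq> A}. emeasure \<nu> K)" for A
  have compact_sets: "K \<in> sets \<nu>" if "compactin X K" for K
    unfolding \<nu>(2) using compactin_imp_closedin[OF X that] by (rule closedin_borel)
  have I_super: "I A + I B \<le> I (A \<union> B)" if AB: "A \<inter> B = {}" for A B
  proof -
    \<comment> \<open>Moving a summand inside a supremum requires a nonempty index set; the empty
      set is always an admissible compact set.\<close>
    have ne: "{K. compactin X K \<and> K \<subseteq> S} \<noteq> {}" for S :: "'a set"
      using compactin_empty by blast
    have "emeasure \<nu> K + emeasure \<nu> L \<le> I (A \<union> B)"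
      if "compactin X K" "K \<subseteq> A" "compactin X L" "L \<subseteq> B" for K L
    proof -
      have "emeasure \<nu> K + emeasure \<nu> L = emeasure \<nu> (K \<union> L)"
        using that AB by (intro plus_emeasure compact_sets) auto
      also have "\<dots> \<le> I (A \<union> B)"
        unfolding I_def using that by (intro SUP_upper) (auto intro: compactin_Un)
      finally show ?thesis .
    qed
    then show ?thesis
      unfolding I_def[of A] I_def[of B]
      by (subst ennreal_SUP_add_left[OF ne, symmetric], intro SUP_least,
          subst ennreal_SUP_add_right[OF ne], intro SUP_least) auto
  qed
  have I_mono: "A \<subseteq> B \<Longrightarrow> I A \<le> I B" for A B
    unfolding I_def by (rule SUP_subset_mono) auto
  have finite_part: "emeasure \<nu> (A \<inter> (\<Union>i<N. D i)) \<le> I (A \<inter> (\<Union>i<N. D i))" for N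
  proof (induction N)
    case (Suc N)
    \<comment> \<open>\<open>?E\<close> is handled by the induction hypothesis; \<open>?F\<close>
      lies in the single set \<open>D N\<close>, so \<open>reg\<close> applies to it.\<close>
    let ?E = "A \<inter> (\<Union>i<N. D i)" and ?F = "A \<inter> D N - (\<Union>i<N. D i)"
    have eq: "A \<inter> (\<Union>i<Suc N. D i) = ?E \<union> ?F" and disj: "?E \<inter> ?F = {}"
      by (auto simp: less_Suc_eq)
    have s: "?E \<in> sets \<nu>" "?F \<in> sets \<nu>"
      using A D by auto
    have "emeasure \<nu> (?E \<union> ?F) = emeasure \<nu> ?E + emeasure \<nu> ?F"
      using s disj by (intro plus_emeasure[symmetric])
    also have "\<dots> \<le> I ?E + I ?F"
      using Suc.IH reg[OF s(2)] by (intro add_mono) (auto simp: I_def)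
    also have "\<dots> \<le> I (?E \<union> ?F)"
      by (rule I_super[OF disj])
    finally show ?case
      unfolding eq .
  qed simp
  have "x \<in> (\<Union>N. A \<inter> (\<Union>i<N. D i))" if x: "x \<in> A" for x
  proof -
    obtain n where "x \<in> D n"
      using x D(2) sets.sets_into_space[OF A] \<nu>(1) by blast
    then show ?thesis
      using x by (intro UN_I[of "Suc n"]) auto
  qed
  then have "A = (\<Union>N. A \<inter> (\<Union>i<N. D i))"
    by blast
  moreover have "(SUP N. emeasure \<nu> (A \<inter> (\<Union>i<N. D i))) = emeasure \<nu> (\<Union>N. A \<inter> (\<Union>i<N. D i))"
    using A D by (intro SUP_emeasure_incseq) (auto simp: incseq_def, force)
  ultimately have "emeasure \<nu> A = (SUP N. emeasure \<nu> (A \<inter> (\<Union>i<N. D i)))"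
    by simp
  also have "\<dots> \<le> I A"
    using finite_part by (intro SUP_least) (meson I_mono Int_lower1 order_trans)
  finally show "emeasure \<nu> A \<le> (SUP K\<in>{K. compactin X K \<and> K \<subseteq> A}. emeasure \<nu> K)"
    by (simp add: I_def)
  show "(SUP K\<in>{K. compactin X K \<and> K \<subseteq> A}. emeasure \<nu> K) \<le> emeasure \<nu> A"
    using A by (intro SUP_least) (auto intro: emeasure_mono)
qed

text \<open>A push-forward along the inverse of \<open>f\<close>, placed on the Borel sets of all of
  \<open>X\<close>. Pullbacks along different charts thereby share one sigma-algebra and can be
  compared and added.\<close>

definition pullback_measure :: "'a topology \<Rightarrow> 'b measure \<Rightarrow> 'a set \<Rightarrow> ('a \<Rightarrow> 'b) \<Rightarrow> 'a measure" where
  "pullback_measure X \<mu> D f =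
     distr (restrict_space \<mu> (f ` D)) (sigma (topspace X) {U. openin X U}) (inv_into D f)"

lemma sets_sigma_openin: "sets (sigma (topspace X) {U. openin X U}) = sigma_sets (topspace X) {U. openin X U}"
  by (rule sets_measure_of) (auto dest: openin_subset)

lemma sets_pullback_measure: "sets (pullback_measure X \<mu> D f) = sigma_sets (topspace X) {U. openin X U}"
  and space_pullback_measure: "space (pullback_measure X \<mu> D f) = topspace X"
  by (simp_all add: pullback_measure_def sets_sigma_openin space_measure_of_conv)

context
  fixes X :: "'a topology" and Y :: "'b topology" and f :: "'a \<Rightarrow> 'b" and D :: "'a set" and \<mu> :: "'b measure"
  assumes hom: "homeomorphic_map (subtopology X D) (subtopology Y (f ` D)) f"
    and D: "openin X D" and fD: "openin Y (f ` D)"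
    and \<mu>: "space \<mu> = topspace Y" "sets \<mu> = sigma_sets (topspace Y) {U. openin Y U}"
begin

lemma open_chart_inj: "inj_on f D"
  using homeomorphic_imp_injective_map[OF hom] openin_subset[OF D] by (simp add: Int_absorb1)

lemma inv_chart_vimage: "inv_into D f -` A \<inter> f ` D = f ` (A \<inter> D)"
  using open_chart_inj by auto

lemma chart_range_sets: "f ` D \<in> sets \<mu>"
  using fD \<mu> by (simp add: sigma_sets.Basic)

lemma inv_chart_measurable:
  "inv_into D f \<in> measurable (restrict_space \<mu> (f ` D)) (sigma (topspace X) {U. openin X U})"
proof (rule measurable_measure_of)
  show "{U. openin X U} \<subseteq> Pow (topspace X)"
    by (auto dest: openin_subset)
  have sp: "space (restrict_space \<mu> (f ` D)) = f ` D"
    using openin_subset[OF fD] \<mu> by (simp add: space_restrict_space Int_absorb2)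
  then show "inv_into D f \<in> space (restrict_space \<mu> (f ` D)) \<rightarrow> topspace X"
    using open_chart_inj openin_subset[OF D] by auto
  fix U assume "U \<in> {U. openin X U}"
  then have "openin (subtopology X D) (U \<inter> D)"
    by (simp add: openin_subtopology_Int)
  then have "openin (subtopology Y (f ` D)) (f ` (U \<inter> D))"
    using homeomorphic_imp_open_map[OF hom] by (simp add: open_map_def)
  then have "openin Y (f ` (U \<inter> D))"
    using fD by (simp add: openin_open_subtopology)
  then have "f ` (U \<inter> D) \<in> sets \<mu>"
    using \<mu> by (simp add: sigma_sets.Basic)
  then show "inv_into D f -` U \<inter> space (restrict_space \<mu> (f ` D)) \<in> sets (restrict_space \<mu> (f ` D))"
    unfolding sp inv_chart_vimage by (subst sets_restrict_space_iff) (use chart_range_sets in auto)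
qed

text \<open>An image under \<open>f\<close> is a preimage under its inverse, and the inverse is
  measurable because \<open>f\<close> is open; so Borel sets have Borel images.\<close>

lemma chart_image_sets:
  assumes "A \<in> sigma_sets (topspace X) {U. openin X U}"
  shows "f ` (A \<inter> D) \<in> sets \<mu>"
proof -
  have "inv_into D f -` A \<inter> space (restrict_space \<mu> (f ` D)) \<in> sets (restrict_space \<mu> (f ` D))"
    using inv_chart_measurable assms by (auto simp: sets_sigma_openin intro: measurable_sets)
  moreover have "space (restrict_space \<mu> (f ` D)) = f ` D"
    using openin_subset[OF fD] \<mu> by (simp add: space_restrict_space Int_absorb2)
  ultimately have "f ` (A \<inter> D) \<in> sets (restrict_space \<mu> (f ` D))"
    by (simp add: inv_chart_vimage)
  then show ?thesis
    using chart_range_sets by (simp add: sets_restrict_space_iff)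
qed

lemma emeasure_pullback_measure:
  assumes A: "A \<in> sigma_sets (topspace X) {U. openin X U}"
  shows "emeasure (pullback_measure X \<mu> D f) A = emeasure \<mu> (f ` (A \<inter> D))"
proof -
  have sp: "space (restrict_space \<mu> (f ` D)) = f ` D"
    using openin_subset[OF fD] \<mu> by (simp add: space_restrict_space Int_absorb2)
  have "emeasure (pullback_measure X \<mu> D f) A = emeasure (restrict_space \<mu> (f ` D)) (f ` (A \<inter> D))"
    unfolding pullback_measure_def using inv_chart_measurable A
    by (subst emeasure_distr) (auto simp: sets_sigma_openin sp inv_chart_vimage)
  also have "\<dots> = emeasure \<mu> (f ` (A \<inter> D))"
    using chart_range_sets by (intro emeasure_restrict_space) auto
  finally show ?thesis .
qed

end

section \<open>The canonical measure\<close>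

context lcsc_topological_group
begin

text \<open>If \<open>U\<close> were null, the translation taking \<open>g\<close> to a point
  \<open>u\<close> of \<open>U\<close> would carry a neighbourhood of \<open>g\<close> into
  \<open>U\<close>, so every point of the group would have a null neighbourhood. Comparison with the
  zero measure by \<open>emeasure_eq_locally\<close> then makes the whole group null.\<close>

lemma haar_open_pos:
  assumes haar: "left_haar_measure G T haar" and U: "openin T U" "U \<noteq> {}"
  shows "emeasure haar U > 0"
proof (rule ccontr)
  assume "\<not> emeasure haar U > 0"
  then have 0: "emeasure haar U = 0"
    by simp
  have sp: "space haar = topspace T" and sets: "sets haar = sigma_sets (topspace T) {U. openin T U}"
    using haar by (auto simp: left_haar_measure_def radon_measure_def)
  then have U_sets: "U \<in> sets haar"
    using U by (simp add: sigma_sets.Basic)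
  obtain u where u: "u \<in> U" "u \<in> carrier G"
    using U openin_subset by fastforce
  have "emeasure haar (carrier G) = emeasure (null_measure haar) (carrier G)"
  proof (rule emeasure_eq_locally[OF second_countable_group sp sets _ openin_topspace])
    fix g assume "g \<in> topspace T"
    then have g: "g \<in> carrier G"
      by simp
    let ?a = "u \<otimes> inv g"
    have a: "?a \<in> carrier G" "?a \<otimes> g = u"
      using u g by (simp_all add: m_assoc)
    then obtain V V' where V: "?a \<in> V" "openin T V'" "g \<in> V'" "\<And>x y. \<lbrakk>x \<in> V; y \<in> V'\<rbrakk> \<Longrightarrow> x \<otimes> y \<in> U"
      using mult_nhds[OF a(1) g U(1)] u by metis
    have "emeasure haar A = 0" if A: "A \<in> sets haar" "A \<subseteq> V'" for A
    proof -
      have "emeasure haar A = emeasure haar (?a <# A)"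
        using haar a A by (simp add: left_haar_measure_def)
      also have "\<dots> \<le> emeasure haar U"
        using V A U_sets by (intro emeasure_mono) (auto simp: l_coset_def)
      finally show ?thesis
        by (simp add: 0)
    qed
    then show "\<exists>N. openin T N \<and> g \<in> N \<and> (\<forall>A\<in>sets haar. A \<subseteq> N \<longrightarrow> emeasure haar A = emeasure (null_measure haar) A)"
      using V by (intro exI[of _ V']) simp
  next
    show "carrier G \<in> sets haar"
      using sets.top[of haar] sp by simp
  qed simp_all
  then show False
    using haar by (simp add: left_haar_measure_def)
qed

end

section \<open>Charts, and existence, uniqueness and positivity of the canonical measure\<close>

locale local_space_haar = local_space G T M
  for G :: "('g, 'b) monoid_scheme" (structure)
    and T :: "'g topology"
    and M :: "('m, 'g) local_space" +
  fixes haar :: "'g measure"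
  assumes haar: "left_haar_measure G T haar"
begin

abbreviation borel_pts :: "'m set set" where
  "borel_pts \<equiv> sigma_sets (pts M) {U. openin (top_of M) U}"

lemma space_haar: "space haar = topspace T"
  and sets_haar: "sets haar = sigma_sets (topspace T) {U. openin T U}"
  using haar by (simp_all add: left_haar_measure_def radon_measure_def)

text \<open>A chart at \<open>p\<close> is the inverse of the orbit map on the neighbourhood of 1
  supplied by homogeneity.\<close>

lemma chart_exists:
  assumes p: "p \<in> pts M"
  shows "\<exists>D f. chart_at G T M p D f"
proof -
  obtain U where U: "openin T U" "\<one> \<in> U" "orbit_embedding T M p U" "openin (top_of M) (act M p ` U)"
    using homogeneous[OF p] by metis
  let ?D = "act M p ` U"
  have UG: "topspace T \<inter> U = U"
    using U(1) openin_subset by blast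
  have "homeomorphic_map (subtopology T U) (subtopology (top_of M) ?D) (act M p)"
    using U(3) UG by (simp add: orbit_embedding_def embedding_map_def)
  then obtain f where f: "homeomorphic_maps (subtopology T U) (subtopology (top_of M) ?D) (act M p) f"
    using homeomorphic_map_maps by blast
  have fU: "f (act M p g) = g" if "g \<in> U" for g
    using f that U(1) openin_subset by (fastforce simp: homeomorphic_maps_def)
  then have "f ` ?D = U"
    by (force simp: image_iff)
  moreover have "homeomorphic_map (subtopology (top_of M) ?D) (subtopology T U) f"
    using f homeomorphic_map_maps homeomorphic_maps_sym by blast
  moreover have "p \<in> ?D"
    using act_one[OF p] U(2) by force
  ultimately have "chart_at G T M p ?D f"
    using U fU by (auto simp: chart_at_def orbit_embedding_def)
  then show ?thesis
    by blast
qed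

lemma chartD:
  assumes "chart_at G T M p D f"
  shows "homeomorphic_map (subtopology (top_of M) D) (subtopology T (f ` D)) f"
    and "openin (top_of M) D" and "openin T (f ` D)" and "p \<in> D"
  using assms by (simp_all add: chart_at_def)

lemma
  assumes f: "chart_at G T M p D f"
  shows chart_inj: "inj_on f D"
    and chart_sets: "A \<in> borel_pts \<Longrightarrow> f ` (A \<inter> D) \<in> sets haar"
    and emeasure_chart_pullback:
      "A \<in> borel_pts \<Longrightarrow> emeasure (pullback_measure (top_of M) haar D f) A = emeasure haar (f ` (A \<inter> D))"
  using open_chart_inj[OF chartD(1-3)[OF f] space_haar sets_haar]
    chart_image_sets[OF chartD(1-3)[OF f] space_haar sets_haar]
    emeasure_pullback_measure[OF chartD(1-3)[OF f] space_haar sets_haar]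
  by blast+

text \<open>A chart is defined as a left inverse of the orbit map. Since \<open>f\<close> takes
  equal values at \<open>p.f(x)\<close> and \<open>x\<close>, its injectivity makes it a right
  inverse as well.\<close>

lemma act_chart:
  assumes f: "chart_at G T M p D f" and x: "x \<in> D"
  shows "(p, f x) \<in> act_dom M" "act M p (f x) = x"
proof -
  show "(p, f x) \<in> act_dom M"
    using f x by (simp add: chart_at_def)
  have "f (act M p (f x)) = f x" "act M p (f x) \<in> D"
    using f x by (auto simp: chart_at_def)
  then show "act M p (f x) = x"
    using chart_inj[OF f] x by (meson inj_onD)
qed

text \<open>In a chart the action becomes right multiplication: for small \<open>k\<close> the
  product \<open>f(x)k\<close> stays in the range, and
  \<open>p.(f(x)k) = p.f(x).k = x.k\<close>.\<close>

lemma chart_act_nhds: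
  assumes f: "chart_at G T M p D f" and x: "x \<in> D"
  obtains V where "openin T V" "\<one> \<in> V"
    "\<And>k. \<lbrakk>k \<in> V; (x, k) \<in> act_dom M\<rbrakk> \<Longrightarrow> act M x k \<in> D \<and> f (act M x k) = f x \<otimes> k"
proof -
  note px = act_chart[OF f x]
  have fx: "f x \<in> carrier G"
    using act_domD px by blast
  then obtain V V' where V: "f x \<in> V" "openin T V'" "\<one> \<in> V'" "\<And>x y. \<lbrakk>x \<in> V; y \<in> V'\<rbrakk> \<Longrightarrow> x \<otimes> y \<in> f ` D"
    using mult_nhds[OF fx one_closed chartD(3)[OF f]] x r_one[OF fx] by (metis imageI)
  have "act M x k \<in> D \<and> f (act M x k) = f x \<otimes> k" if "k \<in> V'" "(x, k) \<in> act_dom M" for k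
  proof -
    have "f x \<otimes> k \<in> f ` D"
      using V that by blast
    then have *: "(p, f x \<otimes> k) \<in> act_dom M" "act M p (f x \<otimes> k) \<in> D" "f (act M p (f x \<otimes> k)) = f x \<otimes> k"
      using f by (auto simp: chart_at_def)
    moreover have "act M p (f x \<otimes> k) = act M x k"
      using act_mult[of p "f x" k] px that * by simp
    ultimately show ?thesis
      by simp
  qed
  then show ?thesis
    using that V by blast
qed

text \<open>Near \<open>x\<close> the two charts read \<open>x.k \<mapsto> f(x) k\<close> and \<open>x.k \<mapsto> g(x) k\<close>.\<close>

lemma chart_change:
  assumes f: "chart_at G T M p D f" and g: "chart_at G T M q E g" and x: "x \<in> D" "x \<in> E"
  obtains N a where "openin (top_of M) N" "x \<in> N" "N \<subseteq> D \<inter> E" "a \<in> carrier G"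
    "\<And>y. y \<in> N \<Longrightarrow> f y = a \<otimes> g y"
proof -
  have xp: "x \<in> pts M"
    using chartD(2)[OF f] x openin_subset by blast
  have G: "f x \<in> carrier G" "g x \<in> carrier G"
    using act_chart[OF f x(1)] act_chart[OF g x(2)] act_domD by blast+
  obtain V1 where V1: "openin T V1" "\<one> \<in> V1"
    "\<And>k. \<lbrakk>k \<in> V1; (x, k) \<in> act_dom M\<rbrakk> \<Longrightarrow> act M x k \<in> D \<and> f (act M x k) = f x \<otimes> k"
    using chart_act_nhds[OF f x(1)] by metis
  obtain V2 where V2: "openin T V2" "\<one> \<in> V2"
    "\<And>k. \<lbrakk>k \<in> V2; (x, k) \<in> act_dom M\<rbrakk> \<Longrightarrow> act M x k \<in> E \<and> g (act M x k) = g x \<otimes> k"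
    using chart_act_nhds[OF g x(2)] by metis
  obtain W where W: "openin T W" "\<one> \<in> W" "orbit_embedding T M x W"
    using homogeneous[OF xp] by metis
  let ?N = "act M x ` (V1 \<inter> V2 \<inter> W)"
  have dom: "(x, k) \<in> act_dom M" if "k \<in> W" for k
    using W that by (auto simp: orbit_embedding_def)
  show ?thesis
  \<comment> \<open>The translation arises by eliminating \<open>k\<close> from
    \<open>f(y) = f(x)k\<close> and \<open>g(y) = g(x)k\<close>.\<close>
  proof (rule that[of ?N "f x \<otimes> inv (g x)"])
    show "openin (top_of M) ?N"
      using dom V1 V2 W by (intro orbit_open) auto
    show "x \<in> ?N"
      using act_one[OF xp] V1 V2 W by force
    show "?N \<subseteq> D \<inter> E"
      using V1 V2 dom by auto
    show "f x \<otimes> inv (g x) \<in> carrier G"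
      using G by simp
    fix y assume "y \<in> ?N"
    then obtain k where k: "k \<in> V1" "k \<in> V2" "k \<in> W" "y = act M x k"
      by blast
    then have "f y = f x \<otimes> k" "g y = g x \<otimes> k" "k \<in> carrier G"
      using V1 V2 dom act_domD by blast+
    then show "f y = f x \<otimes> inv (g x) \<otimes> g y"
      using G by (simp add: m_assoc flip: m_assoc[of "inv (g x)"])
  qed
qed

text \<open>Near each point of \<open>D \<inter> E\<close> the charts differ by a left translation,
  which Haar measure ignores. Passing to pullbacks turns the claim into one about two measures on
  \<open>M\<close>, to which \<open>emeasure_eq_locally\<close> applies.\<close>

lemma haar_chart_eq:
  assumes f: "chart_at G T M p D f" and g: "chart_at G T M q E g"
    and K: "K \<in> borel_pts" "K \<subseteq> D" "K \<subseteq> E"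
  shows "emeasure haar (f ` K) = emeasure haar (g ` K)"
proof -
  let ?\<mu> = "pullback_measure (top_of M) haar D f" and ?\<nu> = "pullback_measure (top_of M) haar E g"
  have "emeasure ?\<mu> K = emeasure ?\<nu> K"
  proof (rule emeasure_eq_locally[OF second_countable_pts, where S = "D \<inter> E"])
    show "openin (top_of M) (D \<inter> E)"
      using chartD f g by blast
    fix x assume "x \<in> D \<inter> E"
    then obtain N a where N: "openin (top_of M) N" "x \<in> N" "N \<subseteq> D \<inter> E" "a \<in> carrier G"
      "\<And>y. y \<in> N \<Longrightarrow> f y = a \<otimes> g y"
      using chart_change[OF f g, of x] by (metis IntE)
    have "emeasure ?\<mu> A = emeasure ?\<nu> A" if A: "A \<in> sets ?\<mu>" "A \<subseteq> N" for A
    proof -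
      have A': "A \<in> borel_pts" "A \<inter> D = A" "A \<inter> E = A"
        using A N by (auto simp: sets_pullback_measure)
      have "f ` A = a <# g ` A"
        using N(5) A(2) by (force simp: l_coset_def)
      moreover have "g ` A \<in> sets haar"
        using chart_sets[OF g A'(1)] A' by simp
      ultimately have "emeasure haar (f ` A) = emeasure haar (g ` A)"
        using haar N(4) by (simp add: left_haar_measure_def)
      then show ?thesis
        using A' by (simp add: emeasure_chart_pullback[OF f] emeasure_chart_pullback[OF g])
    qed
    then show "\<exists>N. openin (top_of M) N \<and> x \<in> N \<and> (\<forall>A\<in>sets ?\<mu>. A \<subseteq> N \<longrightarrow> emeasure ?\<mu> A = emeasure ?\<nu> A)"
      using N by blast
  qed (use K in \<open>auto simp: sets_pullback_measure space_pullback_measure\<close>)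
  then show ?thesis
    using K by (simp add: emeasure_chart_pullback[OF f] emeasure_chart_pullback[OF g] Int_absorb2)
qed

text \<open>The predicate under the definite description in \<open>vol_measure\<close>.\<close>

definition is_vol :: "'m measure \<Rightarrow> bool" where
  "is_vol \<nu> \<longleftrightarrow> radon_measure (top_of M) \<nu> \<and>
    (\<forall>p D f K. chart_at G T M p D f \<and> K \<in> sets \<nu> \<and> K \<subseteq> D \<longrightarrow> emeasure \<nu> K = emeasure haar (f ` K))"

text \<open>The chart formula fixes the measure on Borel subsets of each chart domain, and these
  domains cover \<open>M\<close>.\<close>

lemma is_vol_unique:
  assumes \<mu>: "is_vol \<mu>" and \<nu>: "is_vol \<nu>"
  shows "\<mu> = \<nu>"
proof (rule measure_eqI)
  have sp: "space \<mu> = pts M" and sets: "sets \<mu> = borel_pts" "sets \<nu> = borel_pts"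
    using assms by (auto simp: is_vol_def radon_measure_def)
  then show "sets \<mu> = sets \<nu>"
    by simp
  fix A assume A: "A \<in> sets \<mu>"
  show "emeasure \<mu> A = emeasure \<nu> A"
  proof (rule emeasure_eq_locally[OF second_countable_pts sp sets(1) _ openin_topspace _ A])
    fix p assume "p \<in> pts M"
    then obtain D f where f: "chart_at G T M p D f"
      using chart_exists by blast
    then have "\<forall>A\<in>sets \<mu>. A \<subseteq> D \<longrightarrow> emeasure \<mu> A = emeasure \<nu> A"
      using \<mu> \<nu> sets unfolding is_vol_def by metis
    then show "\<exists>N. openin (top_of M) N \<and> p \<in> N \<and> (\<forall>A\<in>sets \<mu>. A \<subseteq> N \<longrightarrow> emeasure \<mu> A = emeasure \<nu> A)"
      using chartD[OF f] by blast
  qed (use sets sp sets.sets_into_space[OF A] in auto)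
qed

text \<open>Haar measure is pulled back through countably many charts and glued along their
  disjointed domains. By \<open>haar_chart_eq\<close> the result obeys the formula in every chart,
  and local finiteness and inner regularity are carried over from Haar measure.\<close>

lemma is_vol_exists:
  assumes ne: "pts M \<noteq> {}"
  shows "\<exists>\<nu>. is_vol \<nu>"
proof -
  have "\<exists>D :: nat \<Rightarrow> 'm set. (\<forall>n. openin (top_of M) (D n) \<and> (\<exists>p f. chart_at G T M p (D n) f)) \<and> pts M \<subseteq> (\<Union>n. D n)"
  proof (rule Lindelof_local_property[OF second_countable_pts order_refl ne])
    fix p assume "p \<in> pts M"
    then obtain D f where f: "chart_at G T M p D f"
      using chart_exists by blast
    then show "\<exists>N. openin (top_of M) N \<and> p \<in> N \<and> (\<exists>p f. chart_at G T M p N f)"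
      using chartD[OF f] by blast
  qed
  then obtain D :: "nat \<Rightarrow> 'm set" where
    charts: "\<forall>n. \<exists>p f. chart_at G T M p (D n) f" and D: "\<And>n. openin (top_of M) (D n)" "pts M \<subseteq> (\<Union>n. D n)"
    by blast
  from charts obtain c f where f: "\<And>n. chart_at G T M (c n) (D n) (f n)"
    by metis
  let ?B = "sigma (pts M) {U. openin (top_of M) U}"
  have B: "sets ?B = borel_pts"
    by (rule sets_sigma_openin)
  have DB: "D n \<in> borel_pts" for n
    using D(1) by (simp add: sigma_sets.Basic)
  then have C: "disjointed D n \<in> borel_pts" for n
    using sets.range_disjointed_sets[of D ?B] by (auto simp: B)
  obtain \<nu> where \<nu>: "sets \<nu> = sets ?B" "\<And>A. A \<in> sets ?B \<Longrightarrow>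
      emeasure \<nu> A = (\<Sum>n. emeasure (pullback_measure (top_of M) haar (D n) (f n)) (A \<inter> disjointed D n))"
    by (rule glue_measures[of "\<lambda>n. pullback_measure (top_of M) haar (D n) (f n)" ?B "disjointed D"])
      (auto simp: sets_pullback_measure B C)
  have sets: "sets \<nu> = borel_pts"
    using \<nu>(1) B by simp
  have sp: "space \<nu> = pts M"
    using sets_eq_imp_space_eq[OF \<nu>(1)] by (simp add: space_measure_of_conv)
  have vol: "emeasure \<nu> K = emeasure haar (g ` K)" if g: "chart_at G T M p E g" and K: "K \<in> borel_pts" "K \<subseteq> E" for p E g K
  proof -
    let ?\<mu> = "pullback_measure (top_of M) haar E g"
    have KC: "K \<inter> disjointed D n \<in> borel_pts" for n
      using sets.Int[of K ?B "disjointed D n"] K C by (simp add: B)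
    \<comment> \<open>On each piece the gluing chart \<open>f n\<close> is exchanged for the given
      chart \<open>g\<close>, so that the series sums inside one measure.\<close>
    have "emeasure (pullback_measure (top_of M) haar (D n) (f n)) (K \<inter> disjointed D n) = emeasure ?\<mu> (K \<inter> disjointed D n)" for n
      using haar_chart_eq[OF f[of n] g KC[of n]] K disjointed_subset[of D n]
      by (simp add: emeasure_chart_pullback[OF f KC] emeasure_chart_pullback[OF g KC] Int_absorb2 le_infI1 le_infI2)
    then have "emeasure \<nu> K = (\<Sum>n. emeasure ?\<mu> (K \<inter> disjointed D n))"
      using \<nu>(2) K by (simp add: B)
    also have "\<dots> = emeasure ?\<mu> (\<Union>n. K \<inter> disjointed D n)"
      using KC disjoint_family_disjointed[of D]
      by (intro suminf_emeasure) (auto simp: sets_pullback_measure disjoint_family_on_def)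
    also have "(\<Union>n. K \<inter> disjointed D n) = K"
      unfolding Int_UN_distrib[symmetric] UN_disjointed_eq
      using D(2) openin_subset[OF chartD(2)[OF g]] K(2) by blast
    also have "emeasure ?\<mu> K = emeasure haar (g ` K)"
      using K by (simp add: emeasure_chart_pullback[OF g] Int_absorb2)
    finally show ?thesis .
  qed
  have "radon_measure (top_of M) \<nu>"
    unfolding radon_measure_def
  proof (intro conjI ballI)
    show "space \<nu> = pts M" "sets \<nu> = borel_pts"
      by (fact sp sets)+
  next
    fix x assume "x \<in> pts M"
    then obtain E g where g: "chart_at G T M x E g"
      using chart_exists by blast
    then have "x \<in> E" "g x \<in> topspace T"
      using chartD[OF g] openin_subset by blast+
    then obtain U where U: "openin T U" "g x \<in> U" "emeasure haar U < \<infinity>"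
      using haar unfolding left_haar_measure_def radon_measure_def by blast
    let ?N = "{y \<in> E. g y \<in> U}"
    have "openin (subtopology (top_of M) E) {y \<in> topspace (subtopology (top_of M) E). g y \<in> U}"
      using homeomorphic_imp_continuous_map[OF chartD(1)[OF g]] U(1)
      by (intro openin_continuous_map_preimage[of _ T]) (auto intro: continuous_map_into_fulltopology)
    moreover have "topspace (subtopology (top_of M) E) = E"
      using openin_subset[OF chartD(2)[OF g]] by auto
    ultimately have N: "openin (top_of M) ?N"
      using openin_open_subtopology[OF chartD(2)[OF g]] by (simp del: topspace_subtopology)
    then have "emeasure \<nu> ?N = emeasure haar (g ` ?N)"
      by (intro vol[OF g]) (auto simp: sigma_sets.Basic)
    also have "\<dots> \<le> emeasure haar U"
      using U(1) by (intro emeasure_mono) (auto simp: sets_haar intro: sigma_sets.Basic)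
    finally show "\<exists>N. openin (top_of M) N \<and> x \<in> N \<and> emeasure \<nu> N < \<infinity>"
      using N \<open>x \<in> E\<close> U by (intro exI[of _ ?N]) auto
  next
    fix A assume A: "A \<in> sets \<nu>"
    show "emeasure \<nu> A = (SUP K\<in>{K. compactin (top_of M) K \<and> K \<subseteq> A}. emeasure \<nu> K)"
    proof (rule inner_regular_from_cover[OF Hausdorff_pts sp sets _ _ _ A])
      show "D n \<in> sets \<nu>" for n
        using DB sets by simp
      show "(\<Union>n. D n) = pts M"
        using D openin_subset by blast
      fix n A assume A: "A \<in> sets \<nu>" "A \<subseteq> D n"
      then have fA: "f n ` A \<in> sets haar" "emeasure \<nu> A = emeasure haar (f n ` A)"
        using chart_sets[OF f, of A n] vol[OF f, of A n] sets by (simp_all add: Int_absorb2)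
      then have "emeasure \<nu> A = (SUP L\<in>{L. compactin T L \<and> L \<subseteq> f n ` A}. emeasure haar L)"
        using haar by (simp add: left_haar_measure_def radon_measure_def)
      also have "\<dots> \<le> (SUP K\<in>{K. compactin (top_of M) K \<and> K \<subseteq> A}. emeasure \<nu> K)"
      proof (rule SUP_least)
        fix L assume "L \<in> {L. compactin T L \<and> L \<subseteq> f n ` A}"
        then have L: "compactin T L" "L \<subseteq> f n ` A"
          by auto
        \<comment> \<open>The compact set \<open>L\<close> is transported back through the
          homeomorphism \<open>f n\<close>; the chart formula gives both sets the same
          measure.\<close>
        let ?K = "{x \<in> A. f n x \<in> L}"
        have KL: "f n ` ?K = L" and KD: "?K \<subseteq> D n"
          using L A by auto
        have "compactin (subtopology T (f n ` D n)) (f n ` ?K)"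
          unfolding KL using L A by (auto simp: compactin_subtopology)
        then have "compactin (subtopology (top_of M) (D n)) ?K"
          using homeomorphic_map_compactness[OF chartD(1)[OF f], of ?K n] KD openin_subset[OF D(1), of n] by auto
        then have K: "compactin (top_of M) ?K"
          by (simp add: compactin_subtopology)
        have "closedin (top_of M) ?K"
          using Hausdorff_pts K by (rule compactin_imp_closedin)
        then have "?K \<in> borel_pts"
          by (rule closedin_borel)
        then have "emeasure haar L = emeasure \<nu> ?K"
          using vol[OF f _ KD] KL by simp
        also have "\<dots> \<le> (SUP K\<in>{K. compactin (top_of M) K \<and> K \<subseteq> A}. emeasure \<nu> K)"
          using K by (intro SUP_upper) auto
        finally show "emeasure haar L \<le> (SUP K\<in>{K. compactin (top_of M) K \<and> K \<subseteq> A}. emeasure \<nu> K)" .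
      qed
      finally show "emeasure \<nu> A \<le> (SUP K\<in>{K. compactin (top_of M) K \<and> K \<subseteq> A}. emeasure \<nu> K)" .
    qed
  qed
  then show ?thesis
    unfolding is_vol_def using vol sets by blast
qed

lemma is_vol_vol_measure:
  assumes "pts M \<noteq> {}"
  shows "is_vol (vol_measure G T haar M)"
proof -
  have "\<exists>!\<nu>. is_vol \<nu>"
    using is_vol_exists[OF assms] is_vol_unique by blast
  from theI'[OF this] show ?thesis
    unfolding vol_measure_def is_vol_def .
qed

text \<open>A chart domain has the Haar measure of a nonempty open set. Positivity is what makes the
  volume ratios meaningful.\<close>

lemma vol_measure_pos:
  assumes "pts M \<noteq> {}"
  shows "emeasure (vol_measure G T haar M) (pts M) > 0"
proof -
  let ?\<nu> = "vol_measure G T haar M"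
  have \<nu>: "is_vol ?\<nu>"
    using assms by (rule is_vol_vol_measure)
  obtain p D f where f: "chart_at G T M p D f"
    using assms chart_exists by blast
  have s: "D \<in> sets ?\<nu>" "pts M \<in> sets ?\<nu>"
    using \<nu> chartD(2)[OF f] by (auto simp: is_vol_def radon_measure_def sigma_sets.Basic sigma_sets_top)
  have "0 < emeasure haar (f ` D)"
    using chartD[OF f] by (intro haar_open_pos[OF haar]) auto
  also have "\<dots> = emeasure ?\<nu> D"
    using \<nu> f s unfolding is_vol_def by (metis order_refl)
  also have "\<dots> \<le> emeasure ?\<nu> (pts M)"
    using s openin_subset[OF chartD(2)[OF f]] by (intro emeasure_mono) auto
  finally show ?thesis .
qed

end

section \<open>Injectivity radius and sofic points\<close>

lemma compactin_subset_incseq: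
  assumes K: "compactin X K" and U: "\<And>i. openin X (U i)" "incseq U" "K \<subseteq> (\<Union>i. U i)"
  shows "\<exists>i::nat. K \<subseteq> U i"
proof -
  have "\<exists>\<F>. finite \<F> \<and> \<F> \<subseteq> range U \<and> K \<subseteq> \<Union>\<F>"
    using K U(1,3) unfolding compactin_def by (metis imageE)
  then obtain F where F: "finite F" "K \<subseteq> \<Union>(U ` F)"
    by (metis finite_subset_image)
  obtain m where m: "\<And>i. i \<in> F \<Longrightarrow> i \<le> m"
    using F(1) by (meson finite_nat_set_iff_bounded_le)
  have "U i \<subseteq> U m" if "i \<in> F" for i
    using incseqD[OF U(2) m[OF that]] .
  then have "K \<subseteq> U m"
    using F(2) by blast
  then show ?thesis ..
qed

text \<open>\<open>n i\<close> is the largest \<open>k \<le> i\<close> for which \<open>q k\<close> has already settled above \<open>1 - 1/(k+1)\<close>.\<close>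

lemma diagonal_index:
  fixes q :: "nat \<Rightarrow> nat \<Rightarrow> real"
  assumes lim: "\<And>k. q k \<longlonglongrightarrow> 1" and nonneg: "\<And>k i. 0 \<le> q k i"
  obtains n :: "nat \<Rightarrow> nat" where "mono n" "filterlim n at_top sequentially"
    "\<And>i. q (n i) i \<ge> 1 - 1 / real (Suc (n i))"
proof -
  define A where "A i = {k. k \<le> i \<and> (\<forall>j\<ge>i. q k j \<ge> 1 - 1 / real (Suc k))}" for i
  have fin: "finite (A i)" for i
    by (rule finite_subset[of _ "{..i}"]) (auto simp: A_def)
  \<comment> \<open>The index 0 always qualifies, because its threshold \<open>1 - 1/1\<close> is 0
    and \<open>q\<close> is nonnegative.\<close>
  have ne: "A i \<noteq> {}" for i
    using nonneg by (auto simp: A_def intro!: exI[of _ 0])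
  show ?thesis
  proof (rule that[of "\<lambda>i. Max (A i)"])
    \<comment> \<open>\<open>A i\<close> grows with \<open>i\<close>: the bound
      \<open>k \<le> i\<close> relaxes and the range \<open>j \<ge> i\<close> shrinks.\<close>
    show "mono (\<lambda>i. Max (A i))"
      using fin ne by (intro monoI Max_mono) (auto simp: A_def)
    show "q (Max (A i)) i \<ge> 1 - 1 / real (Suc (Max (A i)))" for i
      using Max_in[OF fin ne, of i] by (auto simp: A_def)
    show "filterlim (\<lambda>i. Max (A i)) at_top sequentially"
      unfolding filterlim_at_top
    proof
      fix k
      have "eventually (\<lambda>i. q k i > 1 - 1 / real (Suc k)) sequentially"
        by (rule order_tendstoD[OF lim]) simp
      then obtain J where J: "\<And>j. j \<ge> J \<Longrightarrow> q k j > 1 - 1 / real (Suc k)"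
        by (auto simp: eventually_sequentially)
      have "k \<in> A i" if "i \<ge> max J k" for i
      proof -
        have "\<forall>j\<ge>i. q k j \<ge> 1 - 1 / real (Suc k)"
          using that J by (meson less_imp_le max.boundedE order_trans)
        then show ?thesis
          using that by (simp add: A_def)
      qed
      then have "k \<le> Max (A i)" if "i \<ge> max J k" for i
        using that fin by (simp add: Max_ge)
      then show "\<forall>\<^sub>F i in sequentially. k \<le> Max (A i)"
        unfolding eventually_sequentially by blast
    qed
  qed
qed

section \<open>Balls of a proper metric\<close>

locale lcsc_metric_group = lcsc_topological_group G T
  for G :: "('g, 'b) monoid_scheme" (structure)
    and T :: "'g topology" +
  fixes d :: "'g \<Rightarrow> 'g \<Rightarrow> real"
  assumes proper: "left_invariant_proper_metric G T d"
begin

sublocale metric: Metric_space "carrier G" d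
  rewrites "metric.mtopology = T"
  using proper by (simp_all add: left_invariant_proper_metric_def)

lemma compactin_mcball: "compactin T (metric.mcball \<one> r)"
  using proper by (simp add: left_invariant_proper_metric_def)

lemma precompact_mball: "compactin T (T closure_of metric.mball \<one> r)"
proof (rule closed_compactin[OF compactin_mcball[of r]])
  show "T closure_of metric.mball \<one> r \<subseteq> metric.mcball \<one> r"
    using metric.closedin_mcball by (intro closure_of_minimal) auto
qed simp

text \<open>An exhaustion of the open ball by compact sets, as input for
  \<open>regular_pts_INT\<close>. Closed balls of negative radius are empty and do no harm.\<close>

lemma mball_eq_UN_mcball:
  "metric.mball \<one> \<rho> = (\<Union>n. metric.mcball \<one> (\<rho> - 1 / real (Suc n)))"
proof
  show "metric.mball \<one> \<rho> \<subseteq> (\<Union>n. metric.mcball \<one> (\<rho> - 1 / real (Suc n)))"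
  proof
    fix x assume x: "x \<in> metric.mball \<one> \<rho>"
    then obtain n where "inverse (real (Suc n)) < \<rho> - d \<one> x"
      using reals_Archimedean[of "\<rho> - d \<one> x"] by auto
    then show "x \<in> (\<Union>n. metric.mcball \<one> (\<rho> - 1 / real (Suc n)))"
      using x by (auto simp: inverse_eq_divide intro!: exI[of _ n])
  qed
  have "\<rho> - 1 / real (Suc n) < \<rho>" for n
    by simp
  then show "(\<Union>n. metric.mcball \<one> (\<rho> - 1 / real (Suc n))) \<subseteq> metric.mball \<one> \<rho>"
    by (intro UN_least subsetI) (auto simp del: of_nat_Suc intro: le_less_trans)
qed

end

section \<open>Measurability and volume inequalities for a single local G-space\<close>

locale local_space_metric = local_space_haar G T M haar + lcsc_metric_group G T d
  for G :: "('g, 'b) monoid_scheme" (structure)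
    and T :: "'g topology"
    and M :: "('m, 'g) local_space"
    and haar :: "'g measure"
    and d :: "'g \<Rightarrow> 'g \<Rightarrow> real" +
  assumes nonempty: "pts M \<noteq> {}"
begin

abbreviation vol :: "'m measure" where
  "vol \<equiv> vol_measure G T haar M"

abbreviation injrad_gt :: "real \<Rightarrow> 'm set" where
  "injrad_gt \<rho> \<equiv> {p \<in> pts M. injrad G T d M p > ereal \<rho>}"

lemma sets_vol: "sets vol = borel_pts" and space_vol: "space vol = pts M"
  using is_vol_vol_measure[OF nonempty] by (simp_all add: is_vol_def radon_measure_def)

lemma open_sets_vol: "openin (top_of M) U \<Longrightarrow> U \<in> sets vol"
  by (simp add: sets_vol sigma_sets.Basic)

text \<open>A supremum exceeds \<open>\<rho>\<close> exactly when some admissible radius does, and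
  on open balls \<open>orbit_embedding_iff\<close> turns admissibility into regularity.\<close>

lemma injrad_gt_iff:
  assumes p: "p \<in> pts M" and \<rho>: "\<rho> > 0"
  shows "injrad G T d M p > ereal \<rho> \<longleftrightarrow> (\<exists>r>\<rho>. p \<in> regular_pts (metric.mball \<one> r))"
proof -
  have reg: "p \<in> regular_pts (metric.mball \<one> r) \<longleftrightarrow>
      multiplicative_on G M p (metric.mball \<one> r) \<and> orbit_embedding T M p (metric.mball \<one> r)" for r
    using p by (auto simp: regular_pts_def orbit_embedding_iff)
  have "injrad G T d M p > ereal \<rho> \<longleftrightarrow> (\<exists>r>\<rho>. r > 0 \<and> p \<in> regular_pts (metric.mball \<one> r))"
    unfolding injrad_def less_Sup_iff reg by auto
  then show ?thesis
    using \<rho> by (meson less_trans)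
qed

text \<open>Closed balls of radius slightly above \<open>\<rho>\<close> fit inside any larger open
  ball. Their compactness makes the right side a union of open sets.\<close>

lemma injrad_gt_eq_UN:
  assumes \<rho>: "\<rho> > 0"
  shows "injrad_gt \<rho> = (\<Union>n. regular_pts (metric.mcball \<one> (\<rho> + 1 / real (Suc n))))"
proof (intro equalityI subsetI)
  fix p assume "p \<in> injrad_gt \<rho>"
  then obtain r where r: "r > \<rho>" "p \<in> regular_pts (metric.mball \<one> r)"
    using injrad_gt_iff \<rho> by auto
  then obtain n where n: "inverse (real (Suc n)) < r - \<rho>"
    using reals_Archimedean[of "r - \<rho>"] by auto
  have "\<rho> + 1 / real (Suc n) < r"
    using n by (simp add: inverse_eq_divide)
  then have "metric.mcball \<one> (\<rho> + 1 / real (Suc n)) \<subseteq> metric.mball \<one> r"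
    by (rule metric.mcball_subset_mball_concentric)
  then show "p \<in> (\<Union>n. regular_pts (metric.mcball \<one> (\<rho> + 1 / real (Suc n))))"
    using r regular_pts_mono by blast
next
  fix p assume "p \<in> (\<Union>n. regular_pts (metric.mcball \<one> (\<rho> + 1 / real (Suc n))))"
  then obtain n where n: "p \<in> regular_pts (metric.mcball \<one> (\<rho> + 1 / real (Suc n)))"
    by blast
  then have "p \<in> regular_pts (metric.mball \<one> (\<rho> + 1 / real (Suc n)))"
    using regular_pts_mono[OF metric.mball_subset_mcball] by blast
  moreover have "\<rho> + 1 / real (Suc n) > \<rho>"
    by simp
  moreover have "p \<in> pts M"
    using n by (simp add: regular_pts_def)
  ultimately show "p \<in> injrad_gt \<rho>"
    using injrad_gt_iff \<rho> by blast
qed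

lemma injrad_gt_sets: "\<rho> > 0 \<Longrightarrow> injrad_gt \<rho> \<in> sets vol"
  unfolding injrad_gt_eq_UN
  by (intro open_sets_vol openin_Union) (auto intro: openin_regular_pts compactin_mcball)

text \<open>Regularity on an open ball is a countable intersection of the open conditions for
  smaller closed balls.\<close>

lemma regular_pts_mball_sets: "regular_pts (metric.mball \<one> \<rho>) \<in> sets vol"
proof -
  have "incseq (\<lambda>n. metric.mcball \<one> (\<rho> - 1 / real (Suc n)))"
    by (intro incseq_SucI metric.mcball_subset_concentric) (simp add: frac_le)
  then have "regular_pts (metric.mball \<one> \<rho>) = (\<Inter>n. regular_pts (metric.mcball \<one> (\<rho> - 1 / real (Suc n))))"
    unfolding mball_eq_UN_mcball by (rule regular_pts_INT)
  also have "\<dots> \<in> sets vol"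
    by (intro sets.countable_INT) (auto intro: open_sets_vol openin_regular_pts compactin_mcball)
  finally show ?thesis .
qed

lemma sofic_points_eq_regular_pts:
  assumes "openin T U" "\<one> \<in> U"
  shows "sofic_points G T M U = regular_pts U"
proof -
  have "openin (top_of M) (act M p ` U) \<and> p \<in> act M p ` U" if "p \<in> regular_pts U" for p
  proof
    show "openin (top_of M) (act M p ` U)"
      using that assms by (intro orbit_open) (auto simp: regular_pts_def)
    show "p \<in> act M p ` U"
      using that act_one[of p] assms(2) by (force simp: regular_pts_def)
  qed
  then show ?thesis
    unfolding sofic_points_def using orbit_embedding_iff[OF assms(1)] by (auto simp: regular_pts_def)
qed

context
  assumes finite_vol: "emeasure vol (pts M) < \<infinity>"
begin

lemma finite_measure_vol: "finite_measure vol"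
  using finite_vol by (intro finite_measureI) (simp add: space_vol)

lemma measure_pts_pos: "measure vol (pts M) > 0"
  using vol_measure_pos[OF nonempty] finite_vol
  by (simp add: measure_def enn2real_positive_iff)

lemma injrad_gt_ratio:
  "0 \<le> measure vol (injrad_gt \<rho>) / measure vol (pts M)"
  "measure vol (injrad_gt \<rho>) / measure vol (pts M) \<le> 1"
proof -
  have "measure vol (injrad_gt \<rho>) \<le> measure vol (pts M)"
    by (intro finite_measure.finite_measure_mono[OF finite_measure_vol]) (auto simp: sets_vol sigma_sets_top)
  then show "measure vol (injrad_gt \<rho>) / measure vol (pts M) \<le> 1"
    using measure_pts_pos by simp
qed simp

text \<open>An injectivity radius above \<open>\<rho>\<close> gives regularity on a ball larger than
  \<open>B(\<rho>)\<close>, hence membership in \<open>M[B(\<rho>)]\<close>.\<close>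

lemma sofic_approx_within_mball:
  assumes \<rho>: "\<rho> > 0" and le: "1 - \<epsilon> \<le> measure vol (injrad_gt \<rho>) / measure vol (pts M)"
  shows "sofic_approx_within G T haar (metric.mball \<one> \<rho>) \<epsilon> M"
proof -
  have eq: "sofic_points G T M (metric.mball \<one> \<rho>) = regular_pts (metric.mball \<one> \<rho>)"
    using \<rho> by (intro sofic_points_eq_regular_pts) auto
  have "injrad_gt \<rho> \<subseteq> regular_pts (metric.mball \<one> \<rho>)"
    using injrad_gt_iff[OF _ \<rho>] regular_pts_mono[OF metric.mball_subset_concentric[OF less_imp_le]] by blast
  then have "measure vol (injrad_gt \<rho>) \<le> measure vol (sofic_points G T M (metric.mball \<one> \<rho>))"
    unfolding eq by (intro finite_measure.finite_measure_mono[OF finite_measure_vol] regular_pts_mball_sets)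
  moreover have "(1 - \<epsilon>) * measure vol (pts M) \<le> measure vol (injrad_gt \<rho>)"
    using le measure_pts_pos by (simp add: pos_le_divide_eq)
  ultimately show ?thesis
    using finite_vol by (simp add: sofic_approx_within_def)
qed

end

text \<open>Points of \<open>M[U]\<close> are regular on the ball of radius \<open>r\<close>; the
  strict gap between \<open>\<rho>\<close> and \<open>r\<close> yields the strict inequality for the
  injectivity radius.\<close>

lemma sofic_approx_within_injrad:
  assumes sofic: "sofic_approx_within G T haar U \<epsilon> M" and U: "openin T U" "metric.mcball \<one> r \<subseteq> U"
    and r: "0 < \<rho>" "\<rho> < r"
  shows "1 - \<epsilon> \<le> measure vol (injrad_gt \<rho>) / measure vol (pts M)"
proof -
  have fin: "emeasure vol (pts M) < \<infinity>"
    using sofic by (simp add: sofic_approx_within_def)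
  have "sofic_points G T M U \<subseteq> regular_pts U"
    unfolding sofic_points_def using orbit_embedding_iff[OF U(1)] by (auto simp: regular_pts_def)
  also have "\<dots> \<subseteq> regular_pts (metric.mball \<one> r)"
    using U(2) metric.mball_subset_mcball by (intro regular_pts_mono) blast
  also have "\<dots> \<subseteq> injrad_gt \<rho>"
    using injrad_gt_iff[OF _ r(1)] r(2) by (auto simp: regular_pts_def)
  \<comment> \<open>Monotonicity asks only the larger set to be measurable, so the Borel property of
    \<open>M[U]\<close> for a general open \<open>U\<close> is never at issue.\<close>
  finally have "measure vol (sofic_points G T M U) \<le> measure vol (injrad_gt \<rho>)"
    using r(1) by (intro finite_measure.finite_measure_mono[OF finite_measure_vol[OF fin]] injrad_gt_sets)
  then have "(1 - \<epsilon>) * measure vol (pts M) \<le> measure vol (injrad_gt \<rho>)"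
    using sofic by (simp add: sofic_approx_within_def)
  then show ?thesis
    using measure_pts_pos[OF fin] by (simp add: pos_le_divide_eq)
qed

end

section \<open>The equivalence for sequences\<close>

theorem theorem3p5:
  fixes G :: "('g, 'b) monoid_scheme"
    and T :: "'g topology"
    and d :: "'g \<Rightarrow> 'g \<Rightarrow> real"
    and haar :: "'g measure"
    and M :: "nat \<Rightarrow> ('m, 'g) local_space"
  assumes "lcsc_group G T"
    and "left_invariant_proper_metric G T d"
    and "left_haar_measure G T haar"
    and "\<And>i. local_G_space G T (M i)"
    and "\<And>i. pts (M i) \<noteq> {}"
  shows "sofic_approximation G T haar M \<longleftrightarrow>
    (\<forall>i. emeasure (vol_measure G T haar (M i)) (pts (M i)) < \<infinity>) \<and>
    (\<forall>\<rho>>0. (\<lambda>i. measure (vol_measure G T haar (M i)) {p \<in> pts (M i). injrad G T d (M i) p > ereal \<rho>}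
                 / measure (vol_measure G T haar (M i)) (pts (M i))) \<longlonglongrightarrow> 1)"
proof -
  interpret lcsc_metric_group G T d
    using assms by unfold_locales
  have space: "local_space_metric G T (M i) haar d" for i
    using assms by unfold_locales
  define q where "q \<rho> i = measure (vol_measure G T haar (M i)) {p \<in> pts (M i). injrad G T d (M i) p > ereal \<rho>}
    / measure (vol_measure G T haar (M i)) (pts (M i))" for \<rho> i
  have "sofic_approximation G T haar M \<longleftrightarrow>
    (\<forall>i. emeasure (vol_measure G T haar (M i)) (pts (M i)) < \<infinity>) \<and> (\<forall>\<rho>>0. q \<rho> \<longlonglongrightarrow> 1)"
  proof (intro iffI conjI allI impI)
    assume "sofic_approximation G T haar M"
    then obtain U \<epsilon> where U: "\<And>i. openin T (U i)" "incseq U" "(\<Union>i. U i) = carrier G"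
      and \<epsilon>: "\<epsilon> \<longlonglongrightarrow> 0" and sofic: "\<And>i. sofic_approx_within G T haar (U i) (\<epsilon> i) (M i)"
      unfolding sofic_approximation_def by blast
    show fin: "emeasure (vol_measure G T haar (M i)) (pts (M i)) < \<infinity>" for i
      using sofic by (simp add: sofic_approx_within_def)
    fix \<rho> :: real assume \<rho>: "\<rho> > 0"
    \<comment> \<open>Any radius above \<open>\<rho>\<close> serves; properness makes the closed
      ball compact, so a single \<open>U j\<close> contains it.\<close>
    obtain j where j: "metric.mcball \<one>\<^bsub>G\<^esub> (\<rho> + 1) \<subseteq> U j"
      using compactin_subset_incseq[OF compactin_mcball U(1,2)] U(3) metric.mcball_subset_mspace by metis
    have "1 - \<epsilon> i \<le> q \<rho> i" if "i \<ge> j" for i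
    proof -
      have "metric.mcball \<one>\<^bsub>G\<^esub> (\<rho> + 1) \<subseteq> U i"
        using j incseqD[OF U(2) that] by blast
      then show ?thesis
        unfolding q_def
        by (rule local_space_metric.sofic_approx_within_injrad[OF space sofic U(1)]) (use \<rho> in auto)
    qed
    then have "\<forall>\<^sub>F i in sequentially. 1 - \<epsilon> i \<le> q \<rho> i"
      by (rule eventually_sequentiallyI)
    moreover have "\<forall>\<^sub>F i in sequentially. q \<rho> i \<le> 1"
      unfolding q_def by (intro always_eventually allI local_space_metric.injrad_gt_ratio(2)[OF space fin])
    moreover have "(\<lambda>i. 1 - \<epsilon> i) \<longlonglongrightarrow> 1"
      using tendsto_diff[OF tendsto_const \<epsilon>, of 1] by simp
    ultimately show "q \<rho> \<longlonglongrightarrow> 1"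
      by (rule tendsto_sandwich[OF _ _ _ tendsto_const])
  next
    assume *: "(\<forall>i. emeasure (vol_measure G T haar (M i)) (pts (M i)) < \<infinity>) \<and> (\<forall>\<rho>>0. q \<rho> \<longlonglongrightarrow> 1)"
    then have fin: "emeasure (vol_measure G T haar (M i)) (pts (M i)) < \<infinity>" for i
      by blast
    \<comment> \<open>Radius \<open>k + 1\<close> is positive even at \<open>k = 0\<close> and
      reciprocal to the tolerance \<open>1/(k + 1)\<close>, so one index sequence drives the balls
      to \<open>G\<close> and the errors to 0.\<close>
    obtain n :: "nat \<Rightarrow> nat" where n: "mono n" "filterlim n at_top sequentially"
      "\<And>i. q (real (Suc (n i))) i \<ge> 1 - 1 / real (Suc (n i))"
    proof (rule diagonal_index[of "\<lambda>k. q (real (Suc k))"])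
      show "q (real (Suc k)) \<longlonglongrightarrow> 1" for k
        using * by simp
      show "0 \<le> q (real (Suc k)) i" for k i
        unfolding q_def by (rule local_space_metric.injrad_gt_ratio(1)[OF space fin])
    qed (rule that; assumption)
    define U where "U i = metric.mball \<one>\<^bsub>G\<^esub> (real (Suc (n i)))" for i
    define \<epsilon> where "\<epsilon> i = 1 / real (Suc (n i))" for i
    have "incseq U"
      unfolding U_def using n(1) by (intro monoI metric.mball_subset_concentric) (simp add: monoD)
    moreover have "(\<Union>i. U i) = carrier G"
    proof
      show "carrier G \<subseteq> (\<Union>i. U i)"
      proof
        fix x assume x: "x \<in> carrier G"
        obtain k :: nat where k: "d \<one>\<^bsub>G\<^esub> x < real k"
          using reals_Archimedean2 by blast
        have "\<forall>\<^sub>F i in sequentially. k \<le> n i"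
          using n(2) by (simp add: filterlim_at_top)
        then obtain i where "k \<le> n i"
          using eventually_happens trivial_limit_sequentially by blast
        then have "x \<in> U i"
          using k x by (simp add: U_def)
        then show "x \<in> (\<Union>i. U i)"
          by blast
      qed
    qed (auto simp: U_def)
    moreover have "decseq \<epsilon>"
      unfolding decseq_def \<epsilon>_def using n(1) by (auto intro!: frac_le simp: monoD)
    moreover have "\<epsilon> \<longlonglongrightarrow> 0"
      using filterlim_compose[OF LIMSEQ_inverse_real_of_nat n(2)] by (simp add: \<epsilon>_def[abs_def] inverse_eq_divide)
    moreover have "sofic_approx_within G T haar (U i) (\<epsilon> i) (M i)" for i
      unfolding U_def using n(3)[of i]
      by (intro local_space_metric.sofic_approx_within_mball[OF space fin]) (simp_all add: q_def \<epsilon>_def)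
    moreover have "openin T (U i)" "\<epsilon> i > 0" "compactin T (T closure_of (U i))" for i
      using precompact_mball by (simp_all add: U_def \<epsilon>_def)
    ultimately show "sofic_approximation G T haar M"
      unfolding sofic_approximation_def by blast
  qed
  then show ?thesis
    by (simp add: q_def[abs_def])
qed

end
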